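(* Consider the linear model $Y=X\beta_0+\epsilon$ where $\epsilon\sim\mathcal N(0,I)$ in $\mathbb R^n$, and $X$ is a random $n\times p$ matrix independent of $\epsilon$ with independent rows $X^{(i)}\sim\mathcal N(0,\Sigma_0)$, $i=1,\dots,n$, where $\Theta_0:=\Sigma_0^{-1}$ exists, $1/\Lambda_{\min}(\Sigma_0)=\mathcal O(1)$ and $\|\Sigma_0\|_\infty=\mathcal O(1)$. Let $g:\mathcal B\to\mathbb R$ and suppose that $T_n$ is a strongly asymptotically unbiased estimator of $g(\beta)$ at $\beta_0\in\mathcal B(d_n)$ with a rate $m_n$ (in a neighbourhood of size $c$). Let $h\in\mathbb R^p$ satisfy $h^T\Sigma_0h=1$ and $\beta_0+h/\sqrt{m_n}\in B(\beta_0,c/\sqrt{m_n})$ for a sufficiently large universal constant $c$. Assume moreover that for some $\dot g(\beta_0)\in\mathbb R^p$ it holds that $$\sqrt{m_n}\,\big(g(\beta_0+h/\sqrt{m_n})-g(\beta_0)\big)=h^T\dot g(\beta_0)+o(1).$$ Then $$n\,\mathrm{var}_{\beta_0}(T_n)\ \ge\ [h^T\dot g(\beta_0)]^2-o(1).$$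
   Context: Asymptotic regime: $n\to\infty$, $p=p_n$ may depend on $n$, and all parameters ($\beta_0,\Sigma_0,h,g,d_n,m_n,\dots$) are sequences that may depend on $n$, the index being suppressed; $\mathcal O(\cdot)$, $o(\cdot)$ refer to $n\to\infty$. "Universal constant" means not depending on $n$ or $p$. $\|A\|_\infty:=\max_{i,j}|A_{ij}|$ for a matrix $A$; $\Lambda_{\min}$ is the smallest eigenvalue; $\|x\|_0$ is the number of non-zero entries of $x$. Parameter set: $\mathcal B\subset\mathbb R^p$ is a parameter space, $d_n$ a known sequence, $C>0$ a universal constant, and $$\mathcal B(d_n):=\{\beta\in\mathcal B:\|\beta\|_0\le d_n,\ \|\beta\|_2\le C\},\qquad B(\beta,\varepsilon):=\{\tilde\beta\in\mathcal B(d_n):\|\tilde\beta-\beta\|_2\le\varepsilon\}.$$ $\mathbb E_\beta$ and $\mathrm{var}_\beta$ denote expectation and variance when the data $(X,Y)$ are generated with regression vector $\beta$; an estimator is a measurable function of $(X,Y)$. Strong asymptotic unbiasedness: let $m_n$ be a sequence with $n=o(m_n)$. $T_n$ is a strongly asymptotically unbiased estimator of $g(\beta)$ at $\beta_0$ (in a neighbourhood of size $c$) with rate $m_n$ if $\mathrm{var}_{\beta_0}(T_n)=\mathcal O(1/n)$ and for every (sequence) $\beta\in B(\beta_0,c/\sqrt{m_n})$ it holds that $\lim_{n\to\infty}\sqrt{m_n}\,(\mathbb E_\beta T_n-g(\beta))=0$. *)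

theory Defs
  imports
    "HOL-Probability.Probability"
    "HOL-Library.Landau_Symbols"
    "Jordan_Normal_Form.Spectral_Radius"
begin

unbundle no vec_syntax and no inner_syntax
hide_type (open) Finite_Cartesian_Product.vec
hide_const (open) Finite_Cartesian_Product.vec Finite_Cartesian_Product.row
  Finite_Cartesian_Product.transpose Finite_Cartesian_Product.mat

text \<open>The dimension \<open>p = p\<^sub>n\<close> varies with \<open>n\<close>, so vectors and matrices are those of
  Jordan_Normal_Form, with the dimension given by the carrier. Their Borel \<open>\<sigma>\<close>-algebras are
  generated by the coordinates.\<close>

definition vec_borel :: "nat \<Rightarrow> real vec measure" where
  "vec_borel k = vimage_algebra (carrier_vec k) (\<lambda>v. \<lambda>i\<in>{..<k}. v $ i) (\<Pi>\<^sub>M i\<in>{..<k}. borel)"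

definition mat_borel :: "nat \<Rightarrow> nat \<Rightarrow> real mat measure" where
  "mat_borel n k = vimage_algebra (carrier_mat n k)
     (\<lambda>A. \<lambda>ij\<in>{..<n} \<times> {..<k}. A $$ ij) (\<Pi>\<^sub>M ij\<in>{..<n} \<times> {..<k}. borel)"

definition vec_norm2 :: "real vec \<Rightarrow> real" where
  "vec_norm2 v = sqrt (v \<bullet> v)"

definition vec_norm0 :: "real vec \<Rightarrow> nat" where
  "vec_norm0 v = card {i. i < dim_vec v \<and> v $ i \<noteq> 0}"

definition mat_max_norm :: "real mat \<Rightarrow> real" where
  "mat_max_norm A = Max (abs ` elements_mat A)"

definition Lambda_min :: "real mat \<Rightarrow> real" where
  "Lambda_min A = Min (spectrum A)"

text \<open>The random vector \<open>Z\<close> is \<open>\<N>(0, \<Sigma>)\<close>-distributed if it has the law of \<open>A \<xi>\<close> for some matrix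
  \<open>A\<close> with \<open>A A\<^sup>T = \<Sigma>\<close> and some vector \<open>\<xi>\<close> of independent standard normal variables. In particular
  \<open>\<Sigma>\<close> is symmetric and positive semidefinite.\<close>

definition centered_normal_vec ::
    "'a measure \<Rightarrow> nat \<Rightarrow> ('a \<Rightarrow> real vec) \<Rightarrow> real mat \<Rightarrow> bool" where
  "centered_normal_vec M k Z \<Sigma> \<longleftrightarrow>
     Z \<in> measurable M (vec_borel k) \<and>
     (\<exists>l A. A \<in> carrier_mat k l \<and> A * transpose_mat A = \<Sigma> \<and>
        distr M (vec_borel k) Z =
        distr (\<Pi>\<^sub>M i\<in>{..<l}. density lborel std_normal_density) (vec_borel k)
          (\<lambda>\<xi>. A *\<^sub>v vec l \<xi>))"

text \<open>Gaussian random design \<open>X\<close> (an \<open>n \<times> p\<close> matrix) and noise \<open>e\<close>, living on the probability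
  space \<open>M\<close>. The library's \<open>indep_var\<close> needs both variables to have the same type, so the
  independence of \<open>X\<close> and \<open>e\<close> is that of the \<open>\<sigma>\<close>-algebras they generate.\<close>

definition gaussian_design_noise ::
    "'a measure \<Rightarrow> nat \<Rightarrow> nat \<Rightarrow> real mat \<Rightarrow> ('a \<Rightarrow> real mat) \<Rightarrow> ('a \<Rightarrow> real vec) \<Rightarrow> bool" where
  "gaussian_design_noise M n p \<Sigma> X e \<longleftrightarrow>
     prob_space M \<and>
     X \<in> measurable M (mat_borel n p) \<and>
     (\<forall>i<n. centered_normal_vec M p (\<lambda>\<omega>. row (X \<omega>) i) \<Sigma>) \<and>
     prob_space.indep_vars M (\<lambda>_. vec_borel p) (\<lambda>i \<omega>. row (X \<omega>) i) {..<n} \<and>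
     centered_normal_vec M n e (1\<^sub>m n) \<and>
     prob_space.indep_set M (sets (vimage_algebra (space M) X (mat_borel n p)))
       (sets (vimage_algebra (space M) e (vec_borel n)))"

text \<open>Joint law of the data \<open>(X, Y)\<close>, \<open>Y = X \<beta> + e\<close>, for the regression vector \<open>\<beta>\<close>; an estimator
  is a measurable function on this space.\<close>

definition data_space :: "nat \<Rightarrow> nat \<Rightarrow> (real mat \<times> real vec) measure" where
  "data_space n p = mat_borel n p \<Otimes>\<^sub>M vec_borel n"

definition data_law ::
    "'a measure \<Rightarrow> nat \<Rightarrow> nat \<Rightarrow> ('a \<Rightarrow> real mat) \<Rightarrow> ('a \<Rightarrow> real vec) \<Rightarrow> real vec
      \<Rightarrow> (real mat \<times> real vec) measure" where
  "data_law M n p X e \<beta> = distr M (data_space n p) (\<lambda>\<omega>. (X \<omega>, X \<omega> *\<^sub>v \<beta> + e \<omega>))"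

definition sparse_params :: "real vec set \<Rightarrow> real \<Rightarrow> real \<Rightarrow> real vec set" where
  "sparse_params B d C = {\<beta> \<in> B. real (vec_norm0 \<beta>) \<le> d \<and> vec_norm2 \<beta> \<le> C}"

definition param_ball :: "real vec set \<Rightarrow> real vec \<Rightarrow> real \<Rightarrow> real vec set" where
  "param_ball S \<beta> r = {\<beta>' \<in> S. vec_norm2 (\<beta>' - \<beta>) \<le> r}"

text \<open>Here \<open>P n \<beta>\<close> is the law of the data of sample size \<open>n\<close> under \<open>\<beta>\<close>, and \<open>S n\<close> is the parameter
  set. Since the Bochner integral of a non-integrable function is \<open>0\<close>, the existence of the variance
  and of the expectations (for all large \<open>n\<close>) is required explicitly.\<close>

definition strongly_asymp_unbiased ::
    "(nat \<Rightarrow> real vec \<Rightarrow> (real mat \<times> real vec) measure) \<Rightarrow> (nat \<Rightarrow> real vec set) \<Rightarrow>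
     (nat \<Rightarrow> real vec \<Rightarrow> real) \<Rightarrow> (nat \<Rightarrow> real vec) \<Rightarrow> real \<Rightarrow> (nat \<Rightarrow> real) \<Rightarrow>
     (nat \<Rightarrow> real mat \<times> real vec \<Rightarrow> real) \<Rightarrow> bool" where
  "strongly_asymp_unbiased P S g \<beta>0 c m T \<longleftrightarrow>
     (\<forall>\<^sub>F n in sequentially.
        integrable (P n (\<beta>0 n)) (T n) \<and> integrable (P n (\<beta>0 n)) (\<lambda>z. (T n z)\<^sup>2)) \<and>
     (\<lambda>n. prob_space.variance (P n (\<beta>0 n)) (T n)) \<in> O(\<lambda>n. 1 / real n) \<and>
     (\<forall>\<beta>. (\<forall>n>0. \<beta> n \<in> param_ball (S n) (\<beta>0 n) (c / sqrt (m n))) \<longrightarrow>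
        (\<forall>\<^sub>F n in sequentially. integrable (P n (\<beta> n)) (T n)) \<and>
        (\<lambda>n. sqrt (m n) * (prob_space.expectation (P n (\<beta> n)) (T n) - g n (\<beta> n)))
           \<longlonglongrightarrow> 0)"

end

theory Submission
  imports Defs
begin

text \<open>Chapman--Robbins inequality in the direction \<open>h\<close>. Put \<open>t = 1 / m\<^sub>n\<close> and
  \<open>\<beta>\<^sub>1 = \<beta>\<^sub>0 + sqrt t h\<close>. The likelihood ratio \<open>L\<close> of the data laws under \<open>\<beta>\<^sub>1\<close> and \<open>\<beta>\<^sub>0\<close> is
  \<open>exp (\<langle>\<epsilon>, u\<rangle> - \<parallel>u\<parallel>\<^sup>2 / 2)\<close> with \<open>u = sqrt t X h\<close>, and \<open>E L\<^sup>2 = E exp \<parallel>u\<parallel>\<^sup>2\<close>. As \<open>h\<^sup>T \<Sigma>\<^sub>0 h = 1\<close>,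
  the entries of \<open>X h\<close> are independent standard normal, so \<open>E L\<^sup>2 - 1\<close> is at most
  \<open>exp (n t / (1 - 2 t)) - 1\<close>, which is asymptotic to \<open>n / m\<^sub>n\<close>. By Cauchy--Schwarz,
  \<open>(E\<^sub>1 T - E\<^sub>0 T)\<^sup>2 \<le> var\<^sub>0 T (E L\<^sup>2 - 1)\<close>. Multiplying by \<open>m\<^sub>n\<close> and inserting the unbiasedness at \<open>\<beta>\<^sub>0\<close>
  and \<open>\<beta>\<^sub>1\<close>, where \<open>n var\<^sub>0 T\<close> is bounded, gives the claim.\<close>

subsection \<open>Measurability of random vectors and matrices\<close>

lemma space_vec_borel: "space (vec_borel k) = carrier_vec k"
  by (simp add: vec_borel_def)

lemma space_mat_borel: "space (mat_borel n k) = carrier_mat n k"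
  by (simp add: mat_borel_def)

lemma measurable_vec_index:
  assumes "f \<in> measurable N (vec_borel k)" "i < k"
  shows "(\<lambda>x. f x $ i) \<in> borel_measurable N"
proof -
  have "(\<lambda>v. \<lambda>i\<in>{..<k}. v $ i) \<in> measurable (vec_borel k) (\<Pi>\<^sub>M i\<in>{..<k}. (borel :: real measure))"
    unfolding vec_borel_def
    by (rule measurable_vimage_algebra1) (auto simp: space_PiM)
  from measurable_compose[OF this measurable_component_singleton[of i]]
  have "(\<lambda>v. v $ i) \<in> borel_measurable (vec_borel k)"
    using assms(2) by simp
  then show ?thesis
    using assms(1) by (rule measurable_compose_rev)
qed

lemma measurable_mat_index:
  assumes "f \<in> measurable N (mat_borel n k)" "i < n" "j < k"
  shows "(\<lambda>x. f x $$ (i, j)) \<in> borel_measurable N"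
proof -
  have "(\<lambda>A. \<lambda>ij\<in>{..<n} \<times> {..<k}. A $$ ij)
      \<in> measurable (mat_borel n k) (\<Pi>\<^sub>M ij\<in>{..<n} \<times> {..<k}. (borel :: real measure))"
    unfolding mat_borel_def
    by (rule measurable_vimage_algebra1) (auto simp: space_PiM)
  from measurable_compose[OF this measurable_component_singleton[of "(i, j)"]]
  have "(\<lambda>A. A $$ (i, j)) \<in> borel_measurable (mat_borel n k)"
    using assms(2,3) by simp
  then show ?thesis
    using assms(1) by (rule measurable_compose_rev)
qed

text \<open>A map into a pullback sigma-algebra is measurable once its composition with the
  generating coordinate map is. This reduces measurability of random vectors to finitely many real
  functions.\<close>

lemma measurable_vec_borelI:
  assumes "f \<in> space N \<rightarrow> carrier_vec k"
    and "\<And>i. i < k \<Longrightarrow> (\<lambda>x. f x $ i) \<in> borel_measurable N"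
  shows "f \<in> measurable N (vec_borel k)"
  unfolding vec_borel_def
  by (rule measurable_vimage_algebra2[OF assms(1)])
    (rule measurable_restrict, use assms(2) in auto)

lemma measurable_vec_borelD:
  assumes "f \<in> measurable N (vec_borel k)" "x \<in> space N"
  shows "f x \<in> carrier_vec k"
  using measurable_space[OF assms] by (simp add: space_vec_borel)

lemma measurable_mat_borelD:
  assumes "f \<in> measurable N (mat_borel n k)" "x \<in> space N"
  shows "f x \<in> carrier_mat n k"
  using measurable_space[OF assms] by (simp add: space_mat_borel)

text \<open>Membership in the carrier fixes the dimension and turns the product into a sum over a
  fixed index set. It is known only on \<open>space N\<close>, hence the passage through
  \<open>measurable_cong\<close>; the next two lemmas follow the same pattern.\<close>

lemma measurable_scalar_prod:
  assumes f: "f \<in> measurable N (vec_borel k)" and g: "g \<in> measurable N (vec_borel k)"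
  shows "(\<lambda>x. f x \<bullet> g x) \<in> borel_measurable N"
proof -
  have "(\<lambda>x. \<Sum>i\<in>{0..<k}. f x $ i * g x $ i) \<in> borel_measurable N"
    by (intro borel_measurable_sum borel_measurable_times measurable_vec_index[OF f]
        measurable_vec_index[OF g]) auto
  moreover have "f x \<bullet> g x = (\<Sum>i\<in>{0..<k}. f x $ i * g x $ i)" if "x \<in> space N" for x
    using measurable_vec_borelD[OF g that] by (simp add: scalar_prod_def)
  ultimately show ?thesis
    by (subst measurable_cong) auto
qed

lemma measurable_vec_add:
  assumes f: "f \<in> measurable N (vec_borel k)" and g: "g \<in> measurable N (vec_borel k)"
  shows "(\<lambda>x. f x + g x) \<in> measurable N (vec_borel k)"
proof (rule measurable_vec_borelI)
  show "(\<lambda>x. f x + g x) \<in> space N \<rightarrow> carrier_vec k"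
    using measurable_vec_borelD[OF f] measurable_vec_borelD[OF g] by auto
  fix i assume i: "i < k"
  have "(\<lambda>x. f x $ i + g x $ i) \<in> borel_measurable N"
    using measurable_vec_index[OF f i] measurable_vec_index[OF g i] by simp
  moreover have "(f x + g x) $ i = f x $ i + g x $ i" if "x \<in> space N" for x
    using measurable_vec_borelD[OF g that] i by simp
  ultimately show "(\<lambda>x. (f x + g x) $ i) \<in> borel_measurable N"
    by (subst measurable_cong) auto
qed

lemma measurable_mult_mat_vec:
  assumes f: "f \<in> measurable N (mat_borel n k)" and g: "g \<in> measurable N (vec_borel k)"
  shows "(\<lambda>x. f x *\<^sub>v g x) \<in> measurable N (vec_borel n)"
proof (rule measurable_vec_borelI)
  show "(\<lambda>x. f x *\<^sub>v g x) \<in> space N \<rightarrow> carrier_vec n"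
    using measurable_mat_borelD[OF f] measurable_vec_borelD[OF g]
    by (auto intro: mult_mat_vec_carrier)
  fix i assume i: "i < n"
  have "(\<lambda>x. \<Sum>j\<in>{0..<k}. f x $$ (i, j) * g x $ j) \<in> borel_measurable N"
    using i by (intro borel_measurable_sum borel_measurable_times measurable_mat_index[OF f]
        measurable_vec_index[OF g]) auto
  moreover have "(f x *\<^sub>v g x) $ i = (\<Sum>j\<in>{0..<k}. f x $$ (i, j) * g x $ j)" if "x \<in> space N" for x
    using measurable_vec_borelD[OF g that] measurable_mat_borelD[OF f that] i
    by (auto simp: scalar_prod_def intro!: sum.cong)
  ultimately show "(\<lambda>x. (f x *\<^sub>v g x) $ i) \<in> borel_measurable N"
    by (subst measurable_cong) auto
qed

lemma measurable_const_vec: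
  "v \<in> carrier_vec k \<Longrightarrow> (\<lambda>_. v) \<in> measurable N (vec_borel k)"
  by (simp add: space_vec_borel)

lemma measurable_vec_of_PiM:
  "vec l \<in> measurable (\<Pi>\<^sub>M i\<in>{..<l}. (borel :: real measure)) (vec_borel l)"
  by (rule measurable_vec_borelI) auto

subsection \<open>Gaussian integrals\<close>

text \<open>Completing the square: \<open>a * x - a\<^sup>2 / 2 - x\<^sup>2 / 2 = - (x - a)\<^sup>2
  / 2\<close>.\<close>

lemma std_normal_density_tilt:
  "exp (a * x - a\<^sup>2 / 2) * std_normal_density x = normal_density a 1 x"
  by (simp add: normal_density_def exp_add[symmetric] power2_eq_square field_simps)

abbreviation std_normal :: "real measure" where
  "std_normal \<equiv> density lborel std_normal_density"

text \<open>One-dimensional Cameron--Martin formula. The tilted density is the normal density with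
  mean \<open>a\<close>, and translation invariance of Lebesgue measure moves the mean into the
  argument of \<open>f\<close>.\<close>

lemma nn_integral_std_normal_tilt:
  "(\<integral>\<^sup>+x. ennreal (exp (a * x - a\<^sup>2 / 2)) * f x \<partial>std_normal) = (\<integral>\<^sup>+x. f (x + a) \<partial>std_normal)"
  if [measurable]: "f \<in> borel_measurable borel"
proof -
  have "(\<integral>\<^sup>+x. ennreal (exp (a * x - a\<^sup>2 / 2)) * f x \<partial>std_normal) =
      (\<integral>\<^sup>+x. ennreal (normal_density a 1 x) * f x \<partial>lborel)"
    by (subst nn_integral_density)
      (auto simp: std_normal_density_tilt[of a, symmetric] ennreal_mult ac_simps intro!: nn_integral_cong)
  also have "\<dots> = (\<integral>\<^sup>+x. ennreal (normal_density a 1 (a + 1 * x)) * f (a + 1 * x) \<partial>lborel)"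
    by (subst nn_integral_real_affine[where c = 1 and t = a]) auto
  also have "\<dots> = (\<integral>\<^sup>+x. f (x + a) \<partial>std_normal)"
    by (subst nn_integral_density) (auto simp: normal_density_def add.commute intro!: nn_integral_cong)
  finally show ?thesis .
qed

lemma prob_space_std_normal: "prob_space std_normal"
  by (rule prob_space_normal_density) simp

lemma nn_integral_std_normal_exp:
  "(\<integral>\<^sup>+x. ennreal (exp (a * x)) \<partial>std_normal) = ennreal (exp (a\<^sup>2 / 2))"
proof -
  interpret prob_space std_normal by (rule prob_space_std_normal)
  have "(\<integral>\<^sup>+x. ennreal (exp (a * x)) \<partial>std_normal) =
      (\<integral>\<^sup>+x. ennreal (exp (a * x - a\<^sup>2 / 2)) * ennreal (exp (a\<^sup>2 / 2)) \<partial>std_normal)"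
    by (intro nn_integral_cong) (simp add: ennreal_mult[symmetric] exp_add[symmetric])
  also have "\<dots> = ennreal (exp (a\<^sup>2 / 2))"
    by (subst nn_integral_std_normal_tilt) (auto simp: emeasure_space_1[simplified])
  finally show ?thesis .
qed

text \<open>Cameron--Martin formula for finitely many independent standard normals. Both measures
  are identified with the product of the tilted one-dimensional laws \<open>N i\<close>, by
  comparing values on boxes.\<close>

lemma distr_shift_PiM_std_normal:
  assumes "finite I"
  shows "distr (\<Pi>\<^sub>M i\<in>I. std_normal) (\<Pi>\<^sub>M i\<in>I. std_normal) (\<lambda>\<xi>. \<lambda>i\<in>I. \<xi> i + a i) =
    density (\<Pi>\<^sub>M i\<in>I. std_normal) (\<lambda>\<xi>. ennreal (exp ((\<Sum>i\<in>I. a i * \<xi> i) - (\<Sum>i\<in>I. (a i)\<^sup>2) / 2)))"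
    (is "?L = ?R")
proof -
  interpret std: prob_space std_normal by (rule prob_space_std_normal)
  interpret product_sigma_finite "\<lambda>_. std_normal" ..
  define N where "N = (\<lambda>i. density std_normal (\<lambda>x. ennreal (exp (a i * x - (a i)\<^sup>2 / 2))))"
  have sets_N [simp, measurable_cong]: "sets (N i) = sets borel" for i by (simp add: N_def)
  have emeasure_N: "emeasure (N i) A = (\<integral>\<^sup>+x. ennreal (exp (a i * x - (a i)\<^sup>2 / 2)) * indicator A x \<partial>std_normal)"
    if "A \<in> sets borel" for i A
    using that unfolding N_def by (subst emeasure_density) auto
  \<comment> \<open>The tilt formula with integrand 1 shows that tilting preserves the total
    mass.\<close>
  have "prob_space (N i)" for i
    by (rule prob_spaceI)
      (use std.emeasure_space_1 in \<open>simp add: N_def emeasure_density nn_integral_std_normal_tilt[where f = "\<lambda>_. 1", simplified]\<close>)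
  then interpret N: product_sigma_finite N
    by (simp add: product_sigma_finite_def prob_space_imp_sigma_finite)
  have [measurable]: "(\<lambda>\<xi>. \<lambda>i\<in>I. \<xi> i + a i) \<in> measurable (\<Pi>\<^sub>M i\<in>I. std_normal) (\<Pi>\<^sub>M i\<in>I. std_normal)"
    by (intro measurable_restrict) simp
  have sets_PiM: "sets (\<Pi>\<^sub>M i\<in>I. std_normal) = sets (PiM I N)"
    by (intro sets_PiM_cong) auto
  have "?L = PiM I N"
  proof (rule N.PiM_eqI[OF assms])
    fix A assume "\<And>i. i \<in> I \<Longrightarrow> A i \<in> sets (N i)"
    then have A [measurable]: "\<And>i. i \<in> I \<Longrightarrow> A i \<in> sets borel" by simp
    have vimage: "(\<lambda>x. x + a i) -` A i \<in> sets borel" if "i \<in> I" for i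
      by (rule measurable_sets_borel[OF _ A[OF that]]) simp
    have "emeasure ?L (Pi\<^sub>E I A) =
        emeasure (\<Pi>\<^sub>M i\<in>I. std_normal) ((\<lambda>\<xi>. \<lambda>i\<in>I. \<xi> i + a i) -` Pi\<^sub>E I A \<inter> space (\<Pi>\<^sub>M i\<in>I. std_normal))"
      using A assms by (intro emeasure_distr) (auto intro!: sets_PiM_I_finite)
    \<comment> \<open>The shift acts on each coordinate separately, so the preimage of a box is a
      box.\<close>
    also have "(\<lambda>\<xi>. \<lambda>i\<in>I. \<xi> i + a i) -` Pi\<^sub>E I A \<inter> space (\<Pi>\<^sub>M i\<in>I. std_normal) =
        Pi\<^sub>E I (\<lambda>i. (\<lambda>x. x + a i) -` A i)"
      by (auto simp: space_PiM PiE_def Pi_iff)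
    also have "emeasure (\<Pi>\<^sub>M i\<in>I. std_normal) \<dots> = (\<Prod>i\<in>I. emeasure std_normal ((\<lambda>x. x + a i) -` A i))"
      using vimage by (intro emeasure_PiM[OF assms]) auto
    also have "\<dots> = (\<Prod>i\<in>I. emeasure (N i) (A i))"
    proof (rule prod.cong)
      fix i assume i: "i \<in> I"
      have "emeasure (N i) (A i) = (\<integral>\<^sup>+x. indicator (A i) (x + a i) \<partial>std_normal)"
        by (simp add: emeasure_N A i nn_integral_std_normal_tilt)
      also have "\<dots> = (\<integral>\<^sup>+x. indicator ((\<lambda>x. x + a i) -` A i) x \<partial>std_normal)"
        by (intro nn_integral_cong) (simp add: indicator_def)
      also have "\<dots> = emeasure std_normal ((\<lambda>x. x + a i) -` A i)"
        using vimage[OF i] by (intro nn_integral_indicator) auto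
      finally show "emeasure std_normal ((\<lambda>x. x + a i) -` A i) = emeasure (N i) (A i)" ..
    qed simp
    finally show "emeasure ?L (Pi\<^sub>E I A) = (\<Prod>i\<in>I. emeasure (N i) (A i))" .
  qed (simp add: sets_PiM)
  moreover have "?R = PiM I N"
  proof (rule N.PiM_eqI[OF assms])
    fix A assume "\<And>i. i \<in> I \<Longrightarrow> A i \<in> sets (N i)"
    then have A [measurable]: "\<And>i. i \<in> I \<Longrightarrow> A i \<in> sets borel" by simp
    have "emeasure ?R (Pi\<^sub>E I A) = (\<integral>\<^sup>+\<xi>. ennreal (exp ((\<Sum>i\<in>I. a i * \<xi> i) - (\<Sum>i\<in>I. (a i)\<^sup>2) / 2)) *
        indicator (Pi\<^sub>E I A) \<xi> \<partial>(\<Pi>\<^sub>M i\<in>I. std_normal))"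
      using A assms by (intro emeasure_density) (auto intro!: sets_PiM_I_finite)
    \<comment> \<open>The exponential of a sum and the indicator of a box both factor over the
      coordinates, which leaves a product of one-dimensional integrals.\<close>
    also have "\<dots> = (\<integral>\<^sup>+\<xi>. (\<Prod>i\<in>I. ennreal (exp (a i * \<xi> i - (a i)\<^sup>2 / 2)) * indicator (A i) (\<xi> i))
        \<partial>(\<Pi>\<^sub>M i\<in>I. std_normal))"
    proof (rule nn_integral_cong)
      fix \<xi> assume \<xi>: "\<xi> \<in> space (\<Pi>\<^sub>M i\<in>I. std_normal)"
      have "indicator (Pi\<^sub>E I A) \<xi> = (\<Prod>i\<in>I. indicator (A i) (\<xi> i) :: ennreal)"
        using \<xi> assms by (auto simp: indicator_def space_PiM PiE_def Pi_iff intro!: prod.neutral[symmetric])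
      moreover have "(\<Sum>i\<in>I. a i * \<xi> i) - (\<Sum>i\<in>I. (a i)\<^sup>2) / 2 = (\<Sum>i\<in>I. a i * \<xi> i - (a i)\<^sup>2 / 2)"
        by (simp add: sum_subtractf sum_divide_distrib)
      ultimately show "ennreal (exp ((\<Sum>i\<in>I. a i * \<xi> i) - (\<Sum>i\<in>I. (a i)\<^sup>2) / 2)) * indicator (Pi\<^sub>E I A) \<xi> =
          (\<Prod>i\<in>I. ennreal (exp (a i * \<xi> i - (a i)\<^sup>2 / 2)) * indicator (A i) (\<xi> i))"
        using assms by (simp add: prod.distrib exp_sum prod_ennreal)
    qed
    also have "\<dots> = (\<Prod>i\<in>I. emeasure (N i) (A i))"
      using A by (subst product_nn_integral_prod[OF assms]) (auto simp: emeasure_N intro!: prod.cong)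
    finally show "emeasure ?R (Pi\<^sub>E I A) = (\<Prod>i\<in>I. emeasure (N i) (A i))" .
  qed (simp add: sets_PiM)
  ultimately show ?thesis by simp
qed

lemma nn_integral_PiM_std_normal_shift:
  assumes "finite I" and [measurable]: "f \<in> borel_measurable (\<Pi>\<^sub>M i\<in>I. borel)"
  shows "(\<integral>\<^sup>+\<xi>. f (\<lambda>i\<in>I. \<xi> i + a i) \<partial>(\<Pi>\<^sub>M i\<in>I. std_normal)) =
    (\<integral>\<^sup>+\<xi>. ennreal (exp ((\<Sum>i\<in>I. a i * \<xi> i) - (\<Sum>i\<in>I. (a i)\<^sup>2) / 2)) * f \<xi> \<partial>(\<Pi>\<^sub>M i\<in>I. std_normal))"
proof -
  let ?Q = "\<Pi>\<^sub>M i\<in>I. std_normal"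
  have "sets ?Q = sets (\<Pi>\<^sub>M i\<in>I. (borel :: real measure))"
    by (intro sets_PiM_cong) auto
  then have [measurable]: "f \<in> borel_measurable ?Q"
    by (simp cong: measurable_cong_sets)
  have [measurable]: "(\<lambda>\<xi>. \<lambda>i\<in>I. \<xi> i + a i) \<in> measurable ?Q ?Q"
    by (intro measurable_restrict) simp
  have "(\<integral>\<^sup>+\<xi>. f (\<lambda>i\<in>I. \<xi> i + a i) \<partial>?Q) = (\<integral>\<^sup>+\<xi>. f \<xi> \<partial>distr ?Q ?Q (\<lambda>\<xi>. \<lambda>i\<in>I. \<xi> i + a i))"
    by (simp add: nn_integral_distr)
  also have "\<dots> = (\<integral>\<^sup>+\<xi>. ennreal (exp ((\<Sum>i\<in>I. a i * \<xi> i) - (\<Sum>i\<in>I. (a i)\<^sup>2) / 2)) * f \<xi> \<partial>?Q)"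
    unfolding distr_shift_PiM_std_normal[OF assms(1)] by (subst nn_integral_density) auto
  finally show ?thesis .
qed

lemma prob_space_PiM_std_normal: "prob_space (\<Pi>\<^sub>M i\<in>I. std_normal)"
  by (rule prob_space_PiM) (rule prob_space_std_normal)

text \<open>The shift formula with a constant integrand: up to the factor
  \<open>exp ((\<Sum>i\<in>I. (a i)\<^sup>2) / 2)\<close> the integrand is a probability
  density.\<close>

lemma nn_integral_PiM_std_normal_exp:
  assumes "finite I"
  shows "(\<integral>\<^sup>+\<xi>. ennreal (exp (\<Sum>i\<in>I. a i * \<xi> i)) \<partial>(\<Pi>\<^sub>M i\<in>I. std_normal)) =
    ennreal (exp ((\<Sum>i\<in>I. (a i)\<^sup>2) / 2))"
proof -
  let ?Q = "\<Pi>\<^sub>M i\<in>I. std_normal"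
  interpret prob_space ?Q by (rule prob_space_PiM_std_normal)
  have "(\<integral>\<^sup>+\<xi>. ennreal (exp (\<Sum>i\<in>I. a i * \<xi> i)) \<partial>?Q) =
    (\<integral>\<^sup>+\<xi>. ennreal (exp ((\<Sum>i\<in>I. a i * \<xi> i) - (\<Sum>i\<in>I. (a i)\<^sup>2) / 2)) *
      ennreal (exp ((\<Sum>i\<in>I. (a i)\<^sup>2) / 2)) \<partial>?Q)"
    by (intro nn_integral_cong) (simp add: ennreal_mult[symmetric] exp_add[symmetric])
  also have "\<dots> = ennreal (exp ((\<Sum>i\<in>I. (a i)\<^sup>2) / 2))"
    by (subst nn_integral_PiM_std_normal_shift[OF assms, symmetric]) (auto simp: emeasure_space_1)
  finally show ?thesis .
qed

text \<open>Linearises the square by \<open>exp (t s\<^sup>2) = E exp (sqrt (2 t) s Z)\<close> with an auxiliary standard normal \<open>Z\<close>,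
  so that only exponentials of linear forms have to be integrated over the product space.\<close>

lemma nn_integral_PiM_std_normal_exp_square:
  assumes "finite I" "(\<Sum>i\<in>I. (w i)\<^sup>2) = 1" "0 \<le> t"
  shows "(\<integral>\<^sup>+\<xi>. ennreal (exp (t * (\<Sum>i\<in>I. w i * \<xi> i)\<^sup>2)) \<partial>(\<Pi>\<^sub>M i\<in>I. std_normal)) =
    (\<integral>\<^sup>+z. ennreal (exp (t * z\<^sup>2)) \<partial>std_normal)"
proof -
  let ?Q = "\<Pi>\<^sub>M i\<in>I. std_normal"
  interpret Q: prob_space ?Q by (rule prob_space_PiM_std_normal)
  interpret std: prob_space std_normal by (rule prob_space_std_normal)
  interpret pair_sigma_finite std_normal ?Q ..
  have "(\<integral>\<^sup>+\<xi>. ennreal (exp (t * (\<Sum>i\<in>I. w i * \<xi> i)\<^sup>2)) \<partial>?Q) =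
      (\<integral>\<^sup>+\<xi>. (\<integral>\<^sup>+z. ennreal (exp (sqrt (2 * t) * (\<Sum>i\<in>I. w i * \<xi> i) * z)) \<partial>std_normal) \<partial>?Q)"
    using assms(3) by (simp add: nn_integral_std_normal_exp power_mult_distrib)
  also have "\<dots> = (\<integral>\<^sup>+z. (\<integral>\<^sup>+\<xi>. ennreal (exp (sqrt (2 * t) * (\<Sum>i\<in>I. w i * \<xi> i) * z)) \<partial>?Q) \<partial>std_normal)"
    by (rule Fubini') measurable
  also have "\<dots> = (\<integral>\<^sup>+z. ennreal (exp (t * z\<^sup>2)) \<partial>std_normal)"
  proof (rule nn_integral_cong)
    fix z :: real
    have "(\<integral>\<^sup>+\<xi>. ennreal (exp (sqrt (2 * t) * (\<Sum>i\<in>I. w i * \<xi> i) * z)) \<partial>?Q) =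
        (\<integral>\<^sup>+\<xi>. ennreal (exp (\<Sum>i\<in>I. (sqrt (2 * t) * z * w i) * \<xi> i)) \<partial>?Q)"
      by (simp add: sum_distrib_left sum_distrib_right mult_ac)
    also have "\<dots> = ennreal (exp ((\<Sum>i\<in>I. (sqrt (2 * t) * z * w i)\<^sup>2) / 2))"
      by (rule nn_integral_PiM_std_normal_exp[OF assms(1)])
    also have "(\<Sum>i\<in>I. (sqrt (2 * t) * z * w i)\<^sup>2) / 2 = t * z\<^sup>2"
      using assms(2,3) by (simp add: power_mult_distrib sum_distrib_left[symmetric])
    finally show "(\<integral>\<^sup>+\<xi>. ennreal (exp (sqrt (2 * t) * (\<Sum>i\<in>I. w i * \<xi> i) * z)) \<partial>?Q) =
        ennreal (exp (t * z\<^sup>2))" .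
  qed
  finally show ?thesis .
qed

text \<open>The integral is the moment generating function of a chi-square variable with one degree
  of freedom, namely \<open>1 / sqrt (1 - 2 * t)\<close>. The exponential bound is preferred to this
  exact value because its \<open>n\<close>-th power stays an exponential with an exponent linear in
  \<open>n\<close>.\<close>

lemma nn_integral_std_normal_exp_square_le:
  assumes "0 \<le> t" "t < 1/2"
  shows "(\<integral>\<^sup>+z. ennreal (exp (t * z\<^sup>2)) \<partial>std_normal) \<le> ennreal (exp (t / (1 - 2 * t)))"
proof -
  \<comment> \<open>The factor \<open>exp (t * z\<^sup>2)\<close> turns the standard normal density
    into a multiple of a centred normal density; \<open>\<sigma>\<close> is both its standard
    deviation and that multiple.\<close>
  define \<sigma> where "\<sigma> = 1 / sqrt (1 - 2 * t)"
  have \<sigma>: "\<sigma> > 0" using assms by (simp add: \<sigma>_def)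
  have \<sigma>2: "\<sigma>\<^sup>2 = 1 / (1 - 2 * t)" using assms by (simp add: \<sigma>_def power_divide)
  have dens: "std_normal_density z * exp (t * z\<^sup>2) = \<sigma> * normal_density 0 \<sigma> z" for z
  proof -
    have "- (z\<^sup>2 / 2) + t * z\<^sup>2 = - (z\<^sup>2 / (2 * \<sigma>\<^sup>2))"
      using assms by (simp add: \<sigma>2 field_simps)
    moreover have "sqrt (2 * pi * \<sigma>\<^sup>2) = sqrt (2 * pi) * \<sigma>"
      using \<sigma> by (simp add: real_sqrt_mult)
    ultimately show ?thesis
      using \<sigma> by (simp add: normal_density_def exp_add[symmetric])
  qed
  interpret prob_space "density lborel (normal_density 0 \<sigma>)"
    by (rule prob_space_normal_density[OF \<sigma>])
  have "(\<integral>\<^sup>+z. ennreal (exp (t * z\<^sup>2)) \<partial>std_normal) = (\<integral>\<^sup>+z. ennreal \<sigma> * ennreal (normal_density 0 \<sigma> z) \<partial>lborel)"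
    using \<sigma> by (subst nn_integral_density)
      (auto simp: ennreal_mult[symmetric] dens intro!: nn_integral_cong)
  also have "\<dots> = ennreal \<sigma> * emeasure (density lborel (normal_density 0 \<sigma>)) UNIV"
    by (simp add: nn_integral_cmult emeasure_density)
  also have "\<dots> = ennreal \<sigma>"
    using emeasure_space_1 by simp
  \<comment> \<open>Squaring removes the root: \<open>\<sigma>\<^sup>2\<close> has the form
    \<open>1 + y\<close>, to which \<open>1 + y \<le> exp y\<close> applies.\<close>
  also have "\<sigma> \<le> exp (t / (1 - 2 * t))"
  proof (rule power2_le_imp_le)
    have "\<sigma>\<^sup>2 = 1 + 2 * (t / (1 - 2 * t))"
      using assms by (simp add: \<sigma>2 field_simps)
    also have "\<dots> \<le> exp (2 * (t / (1 - 2 * t)))"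
      by (rule exp_ge_add_one_self)
    also have "\<dots> = (exp (t / (1 - 2 * t)))\<^sup>2"
      by (rule exp_double)
    finally show "\<sigma>\<^sup>2 \<le> (exp (t / (1 - 2 * t)))\<^sup>2" .
  qed simp
  finally show ?thesis by (simp add: ennreal_leI)
qed

section \<open>Gaussian vectors as linear images of independent standard normals\<close>

lemma mult_mat_vec_transpose:
  assumes "(A :: real mat) \<in> carrier_mat n l" "u \<in> carrier_vec n"
  shows "A *\<^sub>v (transpose_mat A *\<^sub>v u) = (A * transpose_mat A) *\<^sub>v u"
  using assms by (simp add: assoc_mult_mat_vec[of _ n l _ n])

lemma scalar_prod_mult_mat_vec:
  assumes "(A :: real mat) \<in> carrier_mat n l" "u \<in> carrier_vec n" "x \<in> carrier_vec l"
  shows "(A *\<^sub>v x) \<bullet> u = (transpose_mat A *\<^sub>v u) \<bullet> x"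
proof -
  have "(transpose_mat A *\<^sub>v u) \<bullet> x = u \<bullet> (A *\<^sub>v x)"
    by (rule transpose_vec_mult_scalar[OF assms(1,3,2)])
  then show ?thesis
    using assms by (metis comm_scalar_prod mult_mat_vec_carrier)
qed

lemma scalar_prod_vec_function:
  "a \<in> carrier_vec l \<Longrightarrow> a \<bullet> vec l \<xi> = (\<Sum>i<l. a $ i * \<xi> i)"
  by (simp add: scalar_prod_def atLeast0LessThan)

lemma scalar_prod_self: "a \<in> carrier_vec l \<Longrightarrow> a \<bullet> a = (\<Sum>i<l. (a $ i :: real)\<^sup>2)"
  by (simp add: scalar_prod_def atLeast0LessThan power2_eq_square)

lemma measurable_mult_mat_vec_PiM:
  assumes "A \<in> carrier_mat k l"
  shows "(\<lambda>\<xi>. A *\<^sub>v vec l \<xi>) \<in> measurable (\<Pi>\<^sub>M i\<in>{..<l}. (borel :: real measure)) (vec_borel k)"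
  by (rule measurable_mult_mat_vec[OF _ measurable_vec_of_PiM])
    (use assms in \<open>simp add: space_mat_borel\<close>)

lemma measurable_PiM_std_normal:
  "measurable (\<Pi>\<^sub>M i\<in>I. std_normal) N = measurable (\<Pi>\<^sub>M i\<in>I. borel) N"
  by (intro measurable_cong_sets sets_PiM_cong) auto

text \<open>Equality of laws becomes equality of integrals, so that integrals of functions of
  \<open>Z\<close> can be computed on the product space. The matrix \<open>A\<close> need not be
  square.\<close>

lemma nn_integral_centered_normal_vec:
  assumes "centered_normal_vec M k Z \<Sigma>"
  obtains l A where "A \<in> carrier_mat k l" "A * transpose_mat A = \<Sigma>"
    "\<And>f. f \<in> borel_measurable (vec_borel k) \<Longrightarrow>
      (\<integral>\<^sup>+\<omega>. f (Z \<omega>) \<partial>M) = (\<integral>\<^sup>+\<xi>. f (A *\<^sub>v vec l \<xi>) \<partial>(\<Pi>\<^sub>M i\<in>{..<l}. std_normal))"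
proof -
  from assms obtain l A where A: "A \<in> carrier_mat k l" "A * transpose_mat A = \<Sigma>"
    and Z: "Z \<in> measurable M (vec_borel k)"
    and eq: "distr M (vec_borel k) Z = distr (\<Pi>\<^sub>M i\<in>{..<l}. std_normal) (vec_borel k) (\<lambda>\<xi>. A *\<^sub>v vec l \<xi>)"
    unfolding centered_normal_vec_def by auto
  show ?thesis
  proof (rule that[OF A])
    fix f :: "real vec \<Rightarrow> ennreal" assume f: "f \<in> borel_measurable (vec_borel k)"
    have "(\<integral>\<^sup>+\<omega>. f (Z \<omega>) \<partial>M) = (\<integral>\<^sup>+v. f v \<partial>distr M (vec_borel k) Z)"
      using Z f by (simp add: nn_integral_distr)
    also have "\<dots> = (\<integral>\<^sup>+\<xi>. f (A *\<^sub>v vec l \<xi>) \<partial>(\<Pi>\<^sub>M i\<in>{..<l}. std_normal))"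
      unfolding eq using f measurable_mult_mat_vec_PiM[OF A(1)]
      by (intro nn_integral_distr) (simp_all add: measurable_PiM_std_normal)
    finally show "(\<integral>\<^sup>+\<omega>. f (Z \<omega>) \<partial>M) = (\<integral>\<^sup>+\<xi>. f (A *\<^sub>v vec l \<xi>) \<partial>(\<Pi>\<^sub>M i\<in>{..<l}. std_normal))" .
  qed
qed

text \<open>A shift of \<open>A \<xi>\<close> by \<open>u\<close> is a shift of \<open>\<xi>\<close> by \<open>A\<^sup>T u\<close>, because \<open>A A\<^sup>T\<close> is the identity.\<close>

lemma nn_integral_standard_normal_vec_shift:
  assumes Z: "centered_normal_vec M n Z (1\<^sub>m n)" and u: "u \<in> carrier_vec n"
    and f: "f \<in> borel_measurable (vec_borel n)"
  shows "(\<integral>\<^sup>+\<omega>. f (Z \<omega> + u) \<partial>M) = (\<integral>\<^sup>+\<omega>. ennreal (exp (Z \<omega> \<bullet> u - u \<bullet> u / 2)) * f (Z \<omega>) \<partial>M)"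
proof -
  obtain l A where A: "A \<in> carrier_mat n l" and AA: "A * transpose_mat A = 1\<^sub>m n"
    and int: "\<And>f. f \<in> borel_measurable (vec_borel n) \<Longrightarrow>
      (\<integral>\<^sup>+\<omega>. f (Z \<omega>) \<partial>M) = (\<integral>\<^sup>+\<xi>. f (A *\<^sub>v vec l \<xi>) \<partial>(\<Pi>\<^sub>M i\<in>{..<l}. std_normal))"
    by (rule nn_integral_centered_normal_vec[OF Z]) blast
  let ?Q = "\<Pi>\<^sub>M i\<in>{..<l}. std_normal"
  define a where "a = transpose_mat A *\<^sub>v u"
  have a: "a \<in> carrier_vec l" using A u by (simp add: a_def)
  have Aa: "A *\<^sub>v a = u"
    using A u AA by (simp add: a_def mult_mat_vec_transpose)
  \<comment> \<open>Passing from \<open>u\<close> to \<open>a\<close> preserves the squared norm, so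
    the normalising term in the exponent is the same for \<open>\<xi>\<close> and for
    \<open>Z\<close>.\<close>
  have aa: "a \<bullet> a = u \<bullet> u"
    using scalar_prod_mult_mat_vec[OF A u a] Aa by (simp add: a_def)
  have id: "(\<lambda>v. v) \<in> measurable (vec_borel n) (vec_borel n)" by simp
  have shift: "A *\<^sub>v vec l \<xi> + u = A *\<^sub>v vec l (\<lambda>i\<in>{..<l}. \<xi> i + a $ i)" for \<xi>
  proof -
    have "vec l (\<lambda>i\<in>{..<l}. \<xi> i + a $ i) = vec l \<xi> + a" using a by auto
    then show ?thesis using A a Aa by (simp add: mult_add_distrib_mat_vec[of _ n l])
  qed
  have "(\<integral>\<^sup>+\<omega>. f (Z \<omega> + u) \<partial>M) = (\<integral>\<^sup>+\<xi>. f (A *\<^sub>v vec l \<xi> + u) \<partial>?Q)"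
    by (rule int) (rule measurable_compose[OF measurable_vec_add[OF id measurable_const_vec[OF u]] f])
  also have "\<dots> = (\<integral>\<^sup>+\<xi>. ennreal (exp ((\<Sum>i<l. a $ i * \<xi> i) - (\<Sum>i<l. (a $ i)\<^sup>2) / 2)) * f (A *\<^sub>v vec l \<xi>) \<partial>?Q)"
    unfolding shift
    by (rule nn_integral_PiM_std_normal_shift)
      (use measurable_compose[OF measurable_mult_mat_vec_PiM[OF A] f] in auto)
  also have "\<dots> = (\<integral>\<^sup>+\<xi>. ennreal (exp ((A *\<^sub>v vec l \<xi>) \<bullet> u - u \<bullet> u / 2)) * f (A *\<^sub>v vec l \<xi>) \<partial>?Q)"
    using a A u by (simp add: scalar_prod_mult_mat_vec[OF A u] a_def[symmetric] scalar_prod_vec_function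
        scalar_prod_self[symmetric] aa)
  also have "\<dots> = (\<integral>\<^sup>+\<omega>. ennreal (exp (Z \<omega> \<bullet> u - u \<bullet> u / 2)) * f (Z \<omega>) \<partial>M)"
    using f measurable_scalar_prod[OF id measurable_const_vec[OF u]]
    by (intro int[symmetric]) simp
  finally show ?thesis .
qed

text \<open>With \<open>Z\<close> distributed as \<open>A \<xi>\<close>, the variable
  \<open>Z \<omega> \<bullet> h\<close> becomes a linear form in \<open>\<xi>\<close> with
  coefficient vector \<open>w = A\<^sup>T h\<close>. Its squared norm is
  \<open>h\<^sup>T \<Sigma> h = 1\<close>, so the form is standard normal.\<close>

lemma nn_integral_centered_normal_vec_exp_square:
  assumes Z: "centered_normal_vec M k Z \<Sigma>" and h: "h \<in> carrier_vec k" "h \<bullet> (\<Sigma> *\<^sub>v h) = 1" and t: "0 \<le> t"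
  shows "(\<integral>\<^sup>+\<omega>. ennreal (exp (t * (Z \<omega> \<bullet> h)\<^sup>2)) \<partial>M) = (\<integral>\<^sup>+z. ennreal (exp (t * z\<^sup>2)) \<partial>std_normal)"
proof -
  obtain l A where A: "A \<in> carrier_mat k l" and AA: "A * transpose_mat A = \<Sigma>"
    and int: "\<And>f. f \<in> borel_measurable (vec_borel k) \<Longrightarrow>
      (\<integral>\<^sup>+\<omega>. f (Z \<omega>) \<partial>M) = (\<integral>\<^sup>+\<xi>. f (A *\<^sub>v vec l \<xi>) \<partial>(\<Pi>\<^sub>M i\<in>{..<l}. std_normal))"
    by (rule nn_integral_centered_normal_vec[OF Z]) blast
  let ?Q = "\<Pi>\<^sub>M i\<in>{..<l}. std_normal"
  define w where "w = transpose_mat A *\<^sub>v h"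
  have w: "w \<in> carrier_vec l" using A h by (simp add: w_def)
  have "(A *\<^sub>v w) \<bullet> h = w \<bullet> w"
    using scalar_prod_mult_mat_vec[OF A h(1) w] by (simp add: w_def)
  moreover have "A *\<^sub>v w = \<Sigma> *\<^sub>v h"
    using mult_mat_vec_transpose[OF A h(1)] by (simp add: w_def AA)
  moreover have "(\<Sigma> *\<^sub>v h) \<bullet> h = h \<bullet> (\<Sigma> *\<^sub>v h)"
    using A h(1) by (intro comm_scalar_prod[of _ k]) (auto simp: AA[symmetric])
  ultimately have ww: "(\<Sum>i<l. (w $ i)\<^sup>2) = 1"
    using h(2) scalar_prod_self[OF w] by simp
  have "(\<integral>\<^sup>+\<omega>. ennreal (exp (t * (Z \<omega> \<bullet> h)\<^sup>2)) \<partial>M) = (\<integral>\<^sup>+\<xi>. ennreal (exp (t * ((A *\<^sub>v vec l \<xi>) \<bullet> h)\<^sup>2)) \<partial>?Q)"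
    using measurable_scalar_prod[OF measurable_ident_sets[OF refl] measurable_const_vec[OF h(1)]]
    by (intro int) simp
  also have "\<dots> = (\<integral>\<^sup>+\<xi>. ennreal (exp (t * (\<Sum>i<l. w $ i * \<xi> i)\<^sup>2)) \<partial>?Q)"
    using w by (simp add: scalar_prod_mult_mat_vec[OF A h(1)] w_def[symmetric] scalar_prod_vec_function)
  also have "\<dots> = (\<integral>\<^sup>+z. ennreal (exp (t * z\<^sup>2)) \<partial>std_normal)"
    using nn_integral_PiM_std_normal_exp_square[OF finite_lessThan ww t] .
  finally show ?thesis .
qed

subsection \<open>Likelihood ratio of the Gaussian design model\<close>

lemma gaussian_design_noiseD:
  assumes "gaussian_design_noise M n p \<Sigma> X e"
  shows "prob_space M"
    and "X \<in> measurable M (mat_borel n p)"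
    and "e \<in> measurable M (vec_borel n)"
    and "i < n \<Longrightarrow> centered_normal_vec M p (\<lambda>\<omega>. row (X \<omega>) i) \<Sigma>"
    and "prob_space.indep_vars M (\<lambda>_. vec_borel p) (\<lambda>i \<omega>. row (X \<omega>) i) {..<n}"
    and "centered_normal_vec M n e (1\<^sub>m n)"
    and "prob_space.indep_set M (sets (vimage_algebra (space M) X (mat_borel n p)))
       (sets (vimage_algebra (space M) e (vec_borel n)))"
  using assms unfolding gaussian_design_noise_def centered_normal_vec_def by auto

text \<open>Rectangles determine the joint law, and on them independence of the generated
  sigma-algebras is the product rule. Phrasing independence by these sigma-algebras lets
  \<open>X\<close> and \<open>Y\<close> have different types.\<close>

lemma (in prob_space) distr_pair_indep_set:
  assumes X [measurable]: "X \<in> measurable M S" and Y [measurable]: "Y \<in> measurable M T"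
    and indep: "indep_set (sets (vimage_algebra (space M) X S)) (sets (vimage_algebra (space M) Y T))"
  shows "distr M (S \<Otimes>\<^sub>M T) (\<lambda>\<omega>. (X \<omega>, Y \<omega>)) = distr M S X \<Otimes>\<^sub>M distr M T Y"
proof (rule pair_measure_eqI[symmetric])
  interpret X: prob_space "distr M S X" by (rule prob_space_distr) fact
  interpret Y: prob_space "distr M T Y" by (rule prob_space_distr) fact
  show "sigma_finite_measure (distr M S X)" "sigma_finite_measure (distr M T Y)" ..
  fix A B assume "A \<in> sets (distr M S X)" "B \<in> sets (distr M T Y)"
  then have A: "A \<in> sets S" and B: "B \<in> sets T" by auto
  have "emeasure (distr M (S \<Otimes>\<^sub>M T) (\<lambda>\<omega>. (X \<omega>, Y \<omega>))) (A \<times> B) =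
      emeasure M ((X -` A \<inter> space M) \<inter> (Y -` B \<inter> space M))"
    using A B by (subst emeasure_distr) (auto intro!: arg_cong[where f = "emeasure M"])
  also have "\<dots> = ennreal (prob (X -` A \<inter> space M) * prob (Y -` B \<inter> space M))"
    using indep_setD[OF indep in_vimage_algebra[OF A] in_vimage_algebra[OF B]]
    by (simp add: emeasure_eq_measure)
  also have "\<dots> = emeasure (distr M S X) A * emeasure (distr M T Y) B"
    using A B by (simp add: emeasure_distr emeasure_eq_measure ennreal_mult)
  finally show "emeasure (distr M S X) A * emeasure (distr M T Y) B =
      emeasure (distr M (S \<Otimes>\<^sub>M T) (\<lambda>\<omega>. (X \<omega>, Y \<omega>))) (A \<times> B)" ..
qed simp

text \<open>The density of the data law under \<open>\<beta> + b\<close> with respect to that under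
  \<open>\<beta>\<close>, written in the noise \<open>\<epsilon> = Y - x \<beta>\<close> instead of
  \<open>Y\<close>; in this form it does not involve \<open>\<beta>\<close>.\<close>

definition likelihood_ratio :: "real mat \<Rightarrow> real vec \<Rightarrow> real vec \<Rightarrow> real" where
  "likelihood_ratio x \<epsilon> b = exp (\<epsilon> \<bullet> (x *\<^sub>v b) - (x *\<^sub>v b) \<bullet> (x *\<^sub>v b) / 2)"

lemma measurable_data:
  assumes "X \<in> measurable N (mat_borel n p)" "e \<in> measurable N (vec_borel n)" "\<beta> \<in> carrier_vec p"
  shows "(\<lambda>\<omega>. (X \<omega>, X \<omega> *\<^sub>v \<beta> + e \<omega>)) \<in> measurable N (data_space n p)"
  unfolding data_space_def
  by (intro measurable_Pair assms(1,2) measurable_vec_add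
      measurable_mult_mat_vec[OF assms(1) measurable_const_vec[OF assms(3)]])

lemma measurable_likelihood_ratio:
  assumes "X \<in> measurable N (mat_borel n p)" "e \<in> measurable N (vec_borel n)" "b \<in> carrier_vec p"
  shows "(\<lambda>\<omega>. likelihood_ratio (X \<omega>) (e \<omega>) b) \<in> borel_measurable N"
proof -
  have "(\<lambda>\<omega>. X \<omega> *\<^sub>v b) \<in> measurable N (vec_borel n)"
    by (rule measurable_mult_mat_vec[OF assms(1) measurable_const_vec[OF assms(3)]])
  then show ?thesis
    unfolding likelihood_ratio_def using assms(2)
    by (intro borel_measurable_exp[THEN measurable_compose_rev] borel_measurable_diff borel_measurable_divide
        measurable_scalar_prod) auto
qed

context
  fixes M :: "'a measure" and n p :: nat and \<Sigma> :: "real mat"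
    and X :: "'a \<Rightarrow> real mat" and e :: "'a \<Rightarrow> real vec"
  assumes model: "gaussian_design_noise M n p \<Sigma> X e"
begin

interpretation prob_space M
  by (rule gaussian_design_noiseD[OF model])

lemmas measurable_X = gaussian_design_noiseD(2)[OF model]
lemmas measurable_e = gaussian_design_noiseD(3)[OF model]

text \<open>Independence of design and noise allows the noise to be integrated out with the design
  held fixed. Both integrals run over \<open>M\<close>, which avoids a separate space for each
  variable.\<close>

lemma nn_integral_design_noise:
  assumes f: "f \<in> borel_measurable (mat_borel n p \<Otimes>\<^sub>M vec_borel n)"
  shows "(\<integral>\<^sup>+\<omega>. f (X \<omega>, e \<omega>) \<partial>M) = (\<integral>\<^sup>+\<omega>. (\<integral>\<^sup>+\<eta>. f (X \<omega>, e \<eta>) \<partial>M) \<partial>M)"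
proof -
  note [measurable] = measurable_X measurable_e f
  interpret E: prob_space "distr M (vec_borel n) e" by (rule prob_space_distr) simp
  have "(\<integral>\<^sup>+\<omega>. f (X \<omega>, e \<omega>) \<partial>M) =
      (\<integral>\<^sup>+z. f z \<partial>distr M (mat_borel n p \<Otimes>\<^sub>M vec_borel n) (\<lambda>\<omega>. (X \<omega>, e \<omega>)))"
    by (subst nn_integral_distr) auto
  also have "\<dots> = (\<integral>\<^sup>+x. (\<integral>\<^sup>+\<epsilon>. f (x, \<epsilon>) \<partial>distr M (vec_borel n) e) \<partial>distr M (mat_borel n p) X)"
    unfolding distr_pair_indep_set[OF measurable_X measurable_e gaussian_design_noiseD(7)[OF model]]
    by (rule E.nn_integral_fst[symmetric]) measurable
  also have "\<dots> = (\<integral>\<^sup>+\<omega>. (\<integral>\<^sup>+\<epsilon>. f (X \<omega>, \<epsilon>) \<partial>distr M (vec_borel n) e) \<partial>M)"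
    by (subst nn_integral_distr) auto
  also have "\<dots> = (\<integral>\<^sup>+\<omega>. (\<integral>\<^sup>+\<eta>. f (X \<omega>, e \<eta>) \<partial>M) \<partial>M)"
    using measurable_space[OF measurable_X] by (intro nn_integral_cong nn_integral_distr) auto
  finally show ?thesis .
qed

lemma nn_integral_change_of_regression_vector:
  assumes \<beta>: "\<beta> \<in> carrier_vec p" and b: "b \<in> carrier_vec p"
    and f: "f \<in> borel_measurable (data_space n p)"
  shows "(\<integral>\<^sup>+\<omega>. f (X \<omega>, X \<omega> *\<^sub>v (\<beta> + b) + e \<omega>) \<partial>M) =
    (\<integral>\<^sup>+\<omega>. ennreal (likelihood_ratio (X \<omega>) (e \<omega>) b) * f (X \<omega>, X \<omega> *\<^sub>v \<beta> + e \<omega>) \<partial>M)"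
proof -
  let ?N = "mat_borel n p \<Otimes>\<^sub>M vec_borel n"
  note f' = measurable_compose[OF measurable_data[OF measurable_fst measurable_snd] f]
  note lr = measurable_likelihood_ratio[OF measurable_fst measurable_snd b]
  have "(\<integral>\<^sup>+\<omega>. f (X \<omega>, X \<omega> *\<^sub>v (\<beta> + b) + e \<omega>) \<partial>M) =
      (\<integral>\<^sup>+\<omega>. (\<integral>\<^sup>+\<eta>. f (X \<omega>, X \<omega> *\<^sub>v (\<beta> + b) + e \<eta>) \<partial>M) \<partial>M)"
    using nn_integral_design_noise[OF f'[of "\<beta> + b"]] \<beta> b by simp
  also have "\<dots> = (\<integral>\<^sup>+\<omega>. (\<integral>\<^sup>+\<eta>. ennreal (likelihood_ratio (X \<omega>) (e \<eta>) b) *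
      f (X \<omega>, X \<omega> *\<^sub>v \<beta> + e \<eta>) \<partial>M) \<partial>M)"
  proof (rule nn_integral_cong)
    fix \<omega> assume \<omega>: "\<omega> \<in> space M"
    have x: "X \<omega> \<in> carrier_mat n p"
      by (rule measurable_mat_borelD[OF measurable_X \<omega>])
    have xb: "X \<omega> *\<^sub>v b \<in> carrier_vec n" "X \<omega> *\<^sub>v \<beta> \<in> carrier_vec n"
      using x b \<beta> by auto
    let ?f = "\<lambda>\<epsilon>. f (X \<omega>, X \<omega> *\<^sub>v \<beta> + \<epsilon>)"
    have "(\<lambda>_. X \<omega>) \<in> measurable (vec_borel n) (mat_borel n p)"
      using x by (simp add: space_mat_borel)
    from measurable_compose[OF measurable_data[OF this measurable_ident_sets[OF refl] \<beta>] f]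
    have meas: "?f \<in> borel_measurable (vec_borel n)" by simp
    \<comment> \<open>With the design frozen at \<open>X \<omega>\<close>, adding \<open>b\<close>
      to the regression vector shifts the noise by the fixed vector
      \<open>X \<omega> *\<^sub>v b\<close>, so the Gaussian shift formula applies.\<close>
    have "(\<integral>\<^sup>+\<eta>. f (X \<omega>, X \<omega> *\<^sub>v (\<beta> + b) + e \<eta>) \<partial>M) = (\<integral>\<^sup>+\<eta>. ?f (e \<eta> + X \<omega> *\<^sub>v b) \<partial>M)"
    proof (rule nn_integral_cong)
      fix \<eta> assume "\<eta> \<in> space M"
      then have "e \<eta> \<in> carrier_vec n" by (rule measurable_vec_borelD[OF measurable_e])
      then have "X \<omega> *\<^sub>v (\<beta> + b) + e \<eta> = X \<omega> *\<^sub>v \<beta> + (e \<eta> + X \<omega> *\<^sub>v b)"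
        using x \<beta> b xb by (simp add: mult_add_distrib_mat_vec[of _ n p]) (auto intro!: eq_vecI)
      then show "f (X \<omega>, X \<omega> *\<^sub>v (\<beta> + b) + e \<eta>) = ?f (e \<eta> + X \<omega> *\<^sub>v b)" by simp
    qed
    also have "\<dots> = (\<integral>\<^sup>+\<eta>. ennreal (likelihood_ratio (X \<omega>) (e \<eta>) b) * ?f (e \<eta>) \<partial>M)"
      unfolding likelihood_ratio_def
      by (rule nn_integral_standard_normal_vec_shift[OF gaussian_design_noiseD(6)[OF model] xb(1) meas])
    finally show "(\<integral>\<^sup>+\<eta>. f (X \<omega>, X \<omega> *\<^sub>v (\<beta> + b) + e \<eta>) \<partial>M) =
        (\<integral>\<^sup>+\<eta>. ennreal (likelihood_ratio (X \<omega>) (e \<eta>) b) * f (X \<omega>, X \<omega> *\<^sub>v \<beta> + e \<eta>) \<partial>M)" .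
  qed
  \<comment> \<open>Independence, read backwards, recombines the two integrals.\<close>
  also have "\<dots> = (\<integral>\<^sup>+\<omega>. ennreal (likelihood_ratio (X \<omega>) (e \<omega>) b) * f (X \<omega>, X \<omega> *\<^sub>v \<beta> + e \<omega>) \<partial>M)"
    using nn_integral_design_noise[OF borel_measurable_times_ennreal[OF
          measurable_compose[OF lr measurable_ennreal] f'[OF \<beta>]]] by simp
  finally show ?thesis .
qed

lemma data_law_shift:
  assumes \<beta>: "\<beta> \<in> carrier_vec p" and b: "b \<in> carrier_vec p"
  shows "data_law M n p X e (\<beta> + b) =
    distr (density M (\<lambda>\<omega>. ennreal (likelihood_ratio (X \<omega>) (e \<omega>) b))) (data_space n p)
      (\<lambda>\<omega>. (X \<omega>, X \<omega> *\<^sub>v \<beta> + e \<omega>))" (is "_ = ?R")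
proof (rule measure_eqI)
  fix A assume "A \<in> sets (data_law M n p X e (\<beta> + b))"
  then have A [measurable]: "A \<in> sets (data_space n p)" by (simp add: data_law_def)
  note [measurable] = measurable_data[OF measurable_X measurable_e]
    measurable_likelihood_ratio[OF measurable_X measurable_e b]
  have "emeasure (data_law M n p X e (\<beta> + b)) A = (\<integral>\<^sup>+\<omega>. indicator A (X \<omega>, X \<omega> *\<^sub>v (\<beta> + b) + e \<omega>) \<partial>M)"
    using \<beta> b by (simp add: data_law_def nn_integral_indicator[symmetric] nn_integral_distr
        del: nn_integral_indicator)
  also have "\<dots> = (\<integral>\<^sup>+\<omega>. ennreal (likelihood_ratio (X \<omega>) (e \<omega>) b) *
      indicator A (X \<omega>, X \<omega> *\<^sub>v \<beta> + e \<omega>) \<partial>M)"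
    by (rule nn_integral_change_of_regression_vector[OF \<beta> b]) simp
  also have "\<dots> = emeasure ?R A"
    using \<beta> by (simp add: nn_integral_indicator[symmetric] nn_integral_distr nn_integral_density
        del: nn_integral_indicator)
  finally show "emeasure (data_law M n p X e (\<beta> + b)) A = emeasure ?R A" .
qed (simp add: data_law_def)

text \<open>The squared norm of \<open>X h\<close> is a sum over the independent rows, so the
  exponential factors into \<open>n\<close> integrals, each of them a chi-square moment since
  \<open>h\<close> is normalised by \<open>\<Sigma>\<close>.\<close>

lemma nn_integral_exp_design_square:
  assumes h: "h \<in> carrier_vec p" "h \<bullet> (\<Sigma> *\<^sub>v h) = 1" and t: "0 \<le> t" "t < 1/2"
  shows "(\<integral>\<^sup>+\<omega>. ennreal (exp (t * ((X \<omega> *\<^sub>v h) \<bullet> (X \<omega> *\<^sub>v h)))) \<partial>M) \<le> ennreal (exp (n * (t / (1 - 2 * t))))"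
proof -
  let ?Y = "\<lambda>i \<omega>. exp (t * (row (X \<omega>) i \<bullet> h)\<^sup>2)"
  have "(\<lambda>v. v \<bullet> h) \<in> borel_measurable (vec_borel p)"
    by (rule measurable_scalar_prod[OF measurable_ident_sets[OF refl] measurable_const_vec[OF h(1)]])
  then have meas: "(\<lambda>v. exp (t * (v \<bullet> h)\<^sup>2)) \<in> borel_measurable (vec_borel p)"
    by simp
  have indep: "indep_vars (\<lambda>_. borel) ?Y {..<n}"
    by (rule indep_vars_compose2[OF gaussian_design_noiseD(5)[OF model] meas])
  have "(\<integral>\<^sup>+\<omega>. ennreal (exp (t * ((X \<omega> *\<^sub>v h) \<bullet> (X \<omega> *\<^sub>v h)))) \<partial>M) = (\<integral>\<^sup>+\<omega>. (\<Prod>i<n. ennreal (?Y i \<omega>)) \<partial>M)"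
  proof (rule nn_integral_cong)
    fix \<omega> assume "\<omega> \<in> space M"
    then have x: "X \<omega> \<in> carrier_mat n p"
      by (rule measurable_mat_borelD[OF measurable_X])
    then have "X \<omega> *\<^sub>v h \<in> carrier_vec n" using h by auto
    then have "(X \<omega> *\<^sub>v h) \<bullet> (X \<omega> *\<^sub>v h) = (\<Sum>i<n. ((X \<omega> *\<^sub>v h) $ i)\<^sup>2)"
      by (rule scalar_prod_self)
    also have "\<dots> = (\<Sum>i<n. (row (X \<omega>) i \<bullet> h)\<^sup>2)"
      using x by (intro sum.cong) auto
    finally show "ennreal (exp (t * ((X \<omega> *\<^sub>v h) \<bullet> (X \<omega> *\<^sub>v h)))) = (\<Prod>i<n. ennreal (?Y i \<omega>))"
      by (simp add: sum_distrib_left exp_sum prod_ennreal)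
  qed
  also have "\<dots> = (\<Prod>i<n. \<integral>\<^sup>+\<omega>. ennreal (?Y i \<omega>) \<partial>M)"
    using indep_vars_nn_integral[OF finite_lessThan, where X = "\<lambda>i \<omega>. ennreal (?Y i \<omega>)"]
      indep_vars_compose2[OF indep, of "\<lambda>_. ennreal" "\<lambda>_. borel"] by simp
  also have "\<dots> = (\<Prod>i<n. \<integral>\<^sup>+z. ennreal (exp (t * z\<^sup>2)) \<partial>std_normal)"
    by (intro prod.cong refl nn_integral_centered_normal_vec_exp_square[OF _ h t(1)]
        gaussian_design_noiseD(4)[OF model]) auto
  also have "\<dots> \<le> (\<Prod>i<n. ennreal (exp (t / (1 - 2 * t))))"
    by (intro prod_mono_ennreal nn_integral_std_normal_exp_square_le[OF t])
  also have "\<dots> = ennreal (exp (n * (t / (1 - 2 * t))))"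
    by (simp add: ennreal_power flip: exp_of_nat_mult)
  finally show ?thesis .
qed

text \<open>The square of the likelihood ratio for \<open>b\<close> is the likelihood ratio for \<open>2 b\<close> times
  \<open>exp \<parallel>X b\<parallel>\<^sup>2\<close>.\<close>

lemma nn_integral_likelihood_ratio_square:
  assumes h: "h \<in> carrier_vec p" "h \<bullet> (\<Sigma> *\<^sub>v h) = 1" and t: "0 \<le> t" "t < 1/2"
  shows "(\<integral>\<^sup>+\<omega>. ennreal ((likelihood_ratio (X \<omega>) (e \<omega>) (sqrt t \<cdot>\<^sub>v h))\<^sup>2) \<partial>M)
    \<le> ennreal (exp (n * (t / (1 - 2 * t))))"
proof -
  let ?b = "sqrt t \<cdot>\<^sub>v h" and ?b2 = "(2 * sqrt t) \<cdot>\<^sub>v h"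
  let ?f = "\<lambda>z. ennreal (exp (t * ((fst z *\<^sub>v h) \<bullet> (fst z *\<^sub>v h))))"
  have "(\<lambda>z. fst z *\<^sub>v h) \<in> measurable (data_space n p) (vec_borel n)"
    unfolding data_space_def by (rule measurable_mult_mat_vec[OF measurable_fst measurable_const_vec[OF h(1)]])
  from measurable_scalar_prod[OF this this]
  have f: "?f \<in> borel_measurable (data_space n p)" by simp
  have "(\<integral>\<^sup>+\<omega>. ennreal ((likelihood_ratio (X \<omega>) (e \<omega>) ?b)\<^sup>2) \<partial>M) =
      (\<integral>\<^sup>+\<omega>. ennreal (likelihood_ratio (X \<omega>) (e \<omega>) ?b2) * ?f (X \<omega>, X \<omega> *\<^sub>v 0\<^sub>v p + e \<omega>) \<partial>M)"
  proof (rule nn_integral_cong)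
    fix \<omega> assume \<omega>: "\<omega> \<in> space M"
    have x: "X \<omega> \<in> carrier_mat n p" and \<epsilon>: "e \<omega> \<in> carrier_vec n"
      using measurable_mat_borelD[OF measurable_X \<omega>] measurable_vec_borelD[OF measurable_e \<omega>] by auto
    have xh: "X \<omega> *\<^sub>v h \<in> carrier_vec n" using x h by auto
    have "likelihood_ratio (X \<omega>) (e \<omega>) (s \<cdot>\<^sub>v h) =
        exp (s * (e \<omega> \<bullet> (X \<omega> *\<^sub>v h)) - s\<^sup>2 * ((X \<omega> *\<^sub>v h) \<bullet> (X \<omega> *\<^sub>v h)) / 2)" for s
      unfolding likelihood_ratio_def using x h \<epsilon> xh
      by (simp add: mult_mat_vec[of _ n p] scalar_prod_smult_distrib[of _ n] smult_scalar_prod_distrib[of _ n]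
          power2_eq_square)
    then have "(likelihood_ratio (X \<omega>) (e \<omega>) ?b)\<^sup>2 =
        likelihood_ratio (X \<omega>) (e \<omega>) ?b2 * exp (t * ((X \<omega> *\<^sub>v h) \<bullet> (X \<omega> *\<^sub>v h)))"
      using t by (simp add: power_mult_distrib exp_double[symmetric] exp_add[symmetric] algebra_simps)
    then show "ennreal ((likelihood_ratio (X \<omega>) (e \<omega>) ?b)\<^sup>2) =
        ennreal (likelihood_ratio (X \<omega>) (e \<omega>) ?b2) * ?f (X \<omega>, X \<omega> *\<^sub>v 0\<^sub>v p + e \<omega>)"
      by (simp add: ennreal_mult likelihood_ratio_def)
  qed
  also have "\<dots> = (\<integral>\<^sup>+\<omega>. ?f (X \<omega>, X \<omega> *\<^sub>v (0\<^sub>v p + ?b2) + e \<omega>) \<partial>M)"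
    using h by (intro nn_integral_change_of_regression_vector[symmetric] f) auto
  also have "\<dots> \<le> ennreal (exp (n * (t / (1 - 2 * t))))"
    using nn_integral_exp_design_square[OF h t] by simp
  finally show ?thesis .
qed

end

subsection \<open>The Chapman--Robbins bound\<close>

text \<open>The integral of \<open>(f x - s * g x)\<^sup>2\<close> is a quadratic polynomial in
  \<open>s\<close> that is nowhere negative.\<close>

lemma Cauchy_Schwarz_integral:
  fixes f g :: "'a \<Rightarrow> real"
  assumes [simp]: "integrable M (\<lambda>x. (f x)\<^sup>2)" "integrable M (\<lambda>x. (g x)\<^sup>2)" "integrable M (\<lambda>x. f x * g x)"
  shows "(\<integral>x. f x * g x \<partial>M)\<^sup>2 \<le> (\<integral>x. (f x)\<^sup>2 \<partial>M) * (\<integral>x. (g x)\<^sup>2 \<partial>M)"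
proof -
  define A B C where "A = (\<integral>x. (f x)\<^sup>2 \<partial>M)" and "B = (\<integral>x. f x * g x \<partial>M)" and "C = (\<integral>x. (g x)\<^sup>2 \<partial>M)"
  have quad: "0 \<le> A - 2 * s * B + s\<^sup>2 * C" for s
  proof -
    have "0 \<le> (\<integral>x. (f x - s * g x)\<^sup>2 \<partial>M)" by simp
    also have "\<dots> = (\<integral>x. (f x)\<^sup>2 - (2 * s) * (f x * g x) + s\<^sup>2 * (g x)\<^sup>2 \<partial>M)"
      by (intro Bochner_Integration.integral_cong refl) (simp add: power2_eq_square algebra_simps)
    also have "\<dots> = A - 2 * s * B + s\<^sup>2 * C"
      by (simp add: A_def B_def C_def)
    finally show ?thesis .
  qed
  have "C \<ge> 0" by (simp add: C_def)
  have "B\<^sup>2 \<le> A * C"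
  proof (cases "C = 0")
    case True
    have "B = 0"
    proof (rule ccontr)
      assume "B \<noteq> 0"
      \<comment> \<open>For \<open>C = 0\<close> the polynomial is affine in \<open>s\<close>; at
        this point it takes the value -1.\<close>
      then show False using quad[of "(A + 1) / (2 * B)"] True by (simp add: field_simps)
    qed
    then show ?thesis using True by simp
  next
    case False
    \<comment> \<open>The point \<open>s = B / C\<close> minimises the quadratic.\<close>
    have "A - 2 * (B / C) * B + (B / C)\<^sup>2 * C = (A * C - B\<^sup>2) / C"
      using False by (simp add: field_simps power2_eq_square)
    then have "0 \<le> (A * C - B\<^sup>2) / C" using quad[of "B / C"] by simp
    then show ?thesis using False \<open>C \<ge> 0\<close> by (simp add: zero_le_divide_iff)
  qed
  then show ?thesis by (simp add: A_def B_def C_def)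
qed

text \<open>Cauchy--Schwarz for the centred variables \<open>S - E S\<close> and
  \<open>L - 1\<close>. As \<open>L\<close> has mean 1, their covariance is the difference of the
  two expectations, and the second moment of \<open>L - 1\<close> is the chi-square divergence
  \<open>E L\<^sup>2 - 1\<close>.\<close>

lemma (in prob_space) Chapman_Robbins:
  fixes S L :: "'a \<Rightarrow> real"
  assumes S [simp]: "integrable M S" "integrable M (\<lambda>x. (S x)\<^sup>2)"
    and L [simp]: "integrable M L" "integrable M (\<lambda>x. (L x)\<^sup>2)" and L1: "expectation L = 1"
    and LS [simp]: "integrable M (\<lambda>x. L x * S x)"
  shows "(expectation (\<lambda>x. L x * S x) - expectation S)\<^sup>2 \<le> variance S * (expectation (\<lambda>x. (L x)\<^sup>2) - 1)"
proof -
  define \<mu> where "\<mu> = expectation S"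
  have S2: "(\<lambda>x. (S x - \<mu>)\<^sup>2) = (\<lambda>x. (S x)\<^sup>2 - 2 * \<mu> * S x + \<mu>\<^sup>2)"
    by (simp add: power2_eq_square algebra_simps fun_eq_iff)
  have L2: "(\<lambda>x. (L x - 1)\<^sup>2) = (\<lambda>x. (L x)\<^sup>2 - 2 * L x + 1)"
    by (simp add: power2_eq_square algebra_simps fun_eq_iff)
  have SL: "(\<lambda>x. (S x - \<mu>) * (L x - 1)) = (\<lambda>x. L x * S x - S x - \<mu> * L x + \<mu>)"
    by (simp add: algebra_simps fun_eq_iff)
  have "expectation (\<lambda>x. (S x - \<mu>) * (L x - 1)) = expectation (\<lambda>x. L x * S x) - \<mu>"
    unfolding SL by (simp add: L1 prob_space flip: \<mu>_def)
  moreover have "expectation (\<lambda>x. (L x - 1)\<^sup>2) = expectation (\<lambda>x. (L x)\<^sup>2) - 1"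
    unfolding L2 by (simp add: L1 prob_space)
  moreover have "(expectation (\<lambda>x. (S x - \<mu>) * (L x - 1)))\<^sup>2 \<le>
      expectation (\<lambda>x. (S x - \<mu>)\<^sup>2) * expectation (\<lambda>x. (L x - 1)\<^sup>2)"
    by (rule Cauchy_Schwarz_integral) (simp_all add: S2 L2 SL)
  ultimately show ?thesis by (simp add: \<mu>_def)
qed

text \<open>Both data laws are pulled back to \<open>M\<close>, where they are represented by the
  same data map under \<open>M\<close> and under the density \<open>L\<close>; the general
  inequality then applies to \<open>L\<close> and the estimator \<open>S\<close> evaluated at the
  data.\<close>

lemma Chapman_Robbins_gaussian_design:
  assumes model: "gaussian_design_noise M n p \<Sigma> X e"
    and \<beta>: "\<beta> \<in> carrier_vec p"
    and h: "h \<in> carrier_vec p" "h \<bullet> (\<Sigma> *\<^sub>v h) = 1" and t: "0 \<le> t" "t < 1/2"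
    and T [measurable]: "T \<in> borel_measurable (data_space n p)"
    and int: "integrable (data_law M n p X e \<beta>) T" "integrable (data_law M n p X e \<beta>) (\<lambda>z. (T z)\<^sup>2)"
      "integrable (data_law M n p X e (\<beta> + sqrt t \<cdot>\<^sub>v h)) T"
  shows "(prob_space.expectation (data_law M n p X e (\<beta> + sqrt t \<cdot>\<^sub>v h)) T -
      prob_space.expectation (data_law M n p X e \<beta>) T)\<^sup>2
    \<le> prob_space.variance (data_law M n p X e \<beta>) T * (exp (n * (t / (1 - 2 * t))) - 1)"
proof -
  interpret prob_space M by (rule gaussian_design_noiseD[OF model])
  let ?b = "sqrt t \<cdot>\<^sub>v h" and ?D = "\<lambda>\<omega>. (X \<omega>, X \<omega> *\<^sub>v \<beta> + e \<omega>)"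
  define L where "L = (\<lambda>\<omega>. likelihood_ratio (X \<omega>) (e \<omega>) ?b)"
  define S where "S = (\<lambda>\<omega>. T (?D \<omega>))"
  have b: "?b \<in> carrier_vec p" using h by simp
  note X = gaussian_design_noiseD(2)[OF model] and e = gaussian_design_noiseD(3)[OF model]
  have D [measurable]: "?D \<in> measurable M (data_space n p)"
    by (rule measurable_data[OF X e \<beta>])
  have L [measurable]: "L \<in> borel_measurable M"
    unfolding L_def by (rule measurable_likelihood_ratio[OF X e b])
  have L_nonneg: "0 \<le> L \<omega>" for \<omega> by (simp add: L_def likelihood_ratio_def)
  have law_b: "data_law M n p X e (\<beta> + ?b) = distr (density M (\<lambda>\<omega>. ennreal (L \<omega>))) (data_space n p) ?D"
    unfolding L_def by (rule data_law_shift[OF model \<beta> b])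
  have S_int: "integrable M S" "integrable M (\<lambda>\<omega>. (S \<omega>)\<^sup>2)"
    using int(1,2) unfolding data_law_def S_def by (simp_all add: integrable_distr_eq)
  \<comment> \<open>Integrability of \<open>T\<close> under the shifted law is exactly integrability
    of \<open>L \<omega> * S \<omega>\<close> under \<open>M\<close>.\<close>
  have LS_int: "integrable M (\<lambda>\<omega>. L \<omega> * S \<omega>)"
    using int(3) unfolding law_b S_def
    by (simp add: integrable_distr_eq integrable_density L_nonneg)
  have exp_b: "prob_space.expectation (data_law M n p X e (\<beta> + ?b)) T = expectation (\<lambda>\<omega>. L \<omega> * S \<omega>)"
    unfolding law_b S_def by (simp add: integral_distr integral_density L_nonneg)
  have exp_0: "prob_space.expectation (data_law M n p X e \<beta>) f = expectation (\<lambda>\<omega>. f (?D \<omega>))"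
    if "f \<in> borel_measurable (data_space n p)" for f :: "real mat \<times> real vec \<Rightarrow> real"
    unfolding data_law_def using that by (simp add: integral_distr)
  \<comment> \<open>The change of measure applied to the constant function 1.\<close>
  have "(\<integral>\<^sup>+\<omega>. ennreal (L \<omega>) \<partial>M) = 1"
    using nn_integral_change_of_regression_vector[OF model \<beta> b, of "\<lambda>_. 1"]
    by (simp add: L_def emeasure_space_1)
  then have L1: "integrable M L" "expectation L = 1"
    using L_nonneg by (auto intro!: integrableI_nonneg simp: integral_eq_nn_integral)
  have L2: "(\<integral>\<^sup>+\<omega>. ennreal ((L \<omega>)\<^sup>2) \<partial>M) \<le> ennreal (exp (n * (t / (1 - 2 * t))))"
    unfolding L_def by (rule nn_integral_likelihood_ratio_square[OF model h t])
  have L2_int: "integrable M (\<lambda>\<omega>. (L \<omega>)\<^sup>2)"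
    by (rule integrableI_nonneg) (use L2 in \<open>auto simp: le_less_trans[OF _ ennreal_less_top]\<close>)
  have L2_le: "expectation (\<lambda>\<omega>. (L \<omega>)\<^sup>2) \<le> exp (n * (t / (1 - 2 * t)))"
    using L2 by (subst (asm) nn_integral_eq_integral[OF L2_int]) auto
  have "(expectation (\<lambda>\<omega>. L \<omega> * S \<omega>) - expectation S)\<^sup>2 \<le>
      variance S * (expectation (\<lambda>\<omega>. (L \<omega>)\<^sup>2) - 1)"
    by (rule Chapman_Robbins[OF S_int L1(1) L2_int L1(2) LS_int])
  also have "\<dots> \<le> variance S * (exp (n * (t / (1 - 2 * t))) - 1)"
    using L2_le by (intro mult_left_mono) auto
  also have "variance S = prob_space.variance (data_law M n p X e \<beta>) T"
    by (simp add: exp_0 S_def)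
  finally show ?thesis
    unfolding exp_b exp_0[OF T] S_def[symmetric] by simp
qed

subsection \<open>Asymptotics\<close>

text \<open>Write \<open>a\<^sup>2 = D\<^sup>2 - 2 D (D - a) + (D - a)\<^sup>2\<close>. The first
  term is at most \<open>W \<rho>\<close>, which differs from \<open>W\<close> by a null sequence
  because \<open>W\<close> is bounded; the other terms vanish because \<open>D\<close> is bounded
  and \<open>D - a\<close> tends to 0. Only the positive part is controlled, since \<open>W\<close>
  may be much larger than \<open>a\<^sup>2\<close>.\<close>

lemma excess_tendsto_0:
  fixes a D W \<rho> :: "nat \<Rightarrow> real"
  assumes W: "\<forall>\<^sub>F n in sequentially. 0 \<le> W n \<and> W n \<le> K"
    and \<rho>: "\<rho> \<longlonglongrightarrow> 1" and D: "(\<lambda>n. D n - a n) \<longlonglongrightarrow> 0"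
    and le: "\<forall>\<^sub>F n in sequentially. (D n)\<^sup>2 \<le> W n * \<rho> n"
  shows "(\<lambda>n. max 0 ((a n)\<^sup>2 - W n)) \<longlonglongrightarrow> 0"
proof (rule tendsto_sandwich[OF _ _ tendsto_const])
  define \<epsilon> where "\<epsilon> = (\<lambda>n. \<bar>D n - a n\<bar>)"
  let ?u = "\<lambda>n. K * \<bar>\<rho> n - 1\<bar> + \<epsilon> n * (1 + K * \<bar>\<rho> n\<bar>) + (\<epsilon> n)\<^sup>2"
  have \<epsilon>: "\<epsilon> \<longlonglongrightarrow> 0" unfolding \<epsilon>_def using D by (rule tendsto_rabs_zero)
  have "?u \<longlonglongrightarrow> K * \<bar>1 - 1\<bar> + 0 * (1 + K * \<bar>1\<bar>) + 0\<^sup>2"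
    by (intro tendsto_intros \<epsilon> \<rho>)
  then show "?u \<longlonglongrightarrow> 0" by simp
  show "\<forall>\<^sub>F n in sequentially. max 0 ((a n)\<^sup>2 - W n) \<le> ?u n"
    using W le
  proof eventually_elim
    case (elim n)
    then have K: "K \<ge> 0" by linarith
    have \<epsilon>0: "\<epsilon> n \<ge> 0" by (simp add: \<epsilon>_def)
    have "W n * (\<rho> n - 1) \<le> W n * \<bar>\<rho> n - 1\<bar>"
      using elim by (intro mult_left_mono) auto
    also have "\<dots> \<le> K * \<bar>\<rho> n - 1\<bar>"
      using elim by (intro mult_right_mono) auto
    finally have 1: "W n * \<rho> n - W n \<le> K * \<bar>\<rho> n - 1\<bar>" by (simp add: algebra_simps)
    have "W n * \<rho> n \<le> W n * \<bar>\<rho> n\<bar>"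
      using elim by (intro mult_left_mono) auto
    also have "\<dots> \<le> K * \<bar>\<rho> n\<bar>"
      using elim by (intro mult_right_mono) auto
    finally have D2: "(D n)\<^sup>2 \<le> K * \<bar>\<rho> n\<bar>" using elim by linarith
    \<comment> \<open>This bounds \<open>\<bar>D n\<bar>\<close> through
      \<open>(D n)\<^sup>2\<close> without introducing a square root.\<close>
    have "0 \<le> (\<bar>D n\<bar> - 1)\<^sup>2" by simp
    then have "2 * \<bar>D n\<bar> \<le> 1 + (D n)\<^sup>2" by (simp add: power2_diff)
    then have 2: "\<epsilon> n * (2 * \<bar>D n\<bar>) \<le> \<epsilon> n * (1 + K * \<bar>\<rho> n\<bar>)"
      using D2 \<epsilon>0 by (intro mult_left_mono) auto
    have "(a n)\<^sup>2 = (D n)\<^sup>2 - 2 * D n * (D n - a n) + (D n - a n)\<^sup>2"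
      by (simp add: power2_eq_square algebra_simps)
    moreover have "- (2 * D n * (D n - a n)) \<le> \<epsilon> n * (2 * \<bar>D n\<bar>)"
    proof -
      have "- (2 * D n * (D n - a n)) \<le> \<bar>2 * D n * (D n - a n)\<bar>"
        by (rule abs_ge_minus_self)
      also have "\<dots> = \<epsilon> n * (2 * \<bar>D n\<bar>)"
        unfolding abs_mult by (simp add: \<epsilon>_def)
      finally show ?thesis .
    qed
    moreover have "(D n - a n)\<^sup>2 = (\<epsilon> n)\<^sup>2" by (simp add: \<epsilon>_def)
    ultimately have "(a n)\<^sup>2 - W n \<le> ?u n"
      using 1 2 elim by linarith
    moreover have "0 \<le> ?u n" using K \<epsilon>0 by simp
    ultimately show ?case by simp
  qed
qed auto

text \<open>With \<open>t = 1 / m n\<close> and \<open>s = n t / (1 - 2 t)\<close>, the second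
  sequence equals \<open>(exp s - 1) / s\<close> times \<open>1 / (1 - 2 t)\<close>. Both factors
  tend to 1 because \<open>s\<close> and \<open>t\<close> tend to 0.\<close>

lemma chi_square_rate:
  fixes m :: "nat \<Rightarrow> real"
  assumes m_pos: "\<And>n. n > 0 \<Longrightarrow> m n > 0" and m_rate: "(\<lambda>n. real n) \<in> o(m)"
  shows "(\<lambda>n. 1 / m n) \<longlonglongrightarrow> 0"
    and "(\<lambda>n. m n / n * (exp (n * (1 / m n / (1 - 2 * (1 / m n)))) - 1)) \<longlonglongrightarrow> 1"
proof -
  have pos: "\<forall>\<^sub>F n in sequentially. n > 0 \<and> m n > 0"
    using eventually_gt_at_top[of "0::nat"] by eventually_elim (use m_pos in auto)
  have n_m: "(\<lambda>n. n / m n) \<longlonglongrightarrow> 0"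
    by (rule smalloD_tendsto[OF m_rate])
  show inv_m: "(\<lambda>n. 1 / m n) \<longlonglongrightarrow> 0"
  proof (rule tendsto_sandwich[OF _ _ tendsto_const n_m])
    show "\<forall>\<^sub>F n in sequentially. 0 \<le> 1 / m n" "\<forall>\<^sub>F n in sequentially. 1 / m n \<le> n / m n"
      using pos by (eventually_elim, simp add: divide_right_mono)+
  qed
  define s where "s = (\<lambda>n. n * (1 / m n / (1 - 2 * (1 / m n))))"
  have "(\<lambda>n. (n / m n) / (1 - 2 * (1 / m n))) \<longlonglongrightarrow> 0 / (1 - 2 * 0)"
    by (intro tendsto_intros n_m inv_m) simp
  then have s0: "s \<longlonglongrightarrow> 0" by (simp add: s_def)
  have lt: "\<forall>\<^sub>F n in sequentially. 1 / m n < 1 / 2"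
    using inv_m by (rule order_tendstoD) simp
  \<comment> \<open>The limit of the difference quotient of \<open>exp\<close> is taken at a
    punctured neighbourhood of 0.\<close>
  have "\<forall>\<^sub>F n in sequentially. s n \<noteq> 0"
    using pos lt by eventually_elim (auto simp: s_def)
  with s0 have "filterlim s (at 0) sequentially"
    by (simp add: filterlim_at)
  from filterlim_compose[OF lim_exp_minus_1 this]
  have "(\<lambda>n. (exp (s n) - 1) / s n * (1 / (1 - 2 * (1 / m n)))) \<longlonglongrightarrow> 1 * (1 / (1 - 2 * 0))"
    by (intro tendsto_intros inv_m) simp_all
  moreover have "\<forall>\<^sub>F n in sequentially. (exp (s n) - 1) / s n * (1 / (1 - 2 * (1 / m n))) =
      m n / n * (exp (s n) - 1)"
    using pos lt by eventually_elim (simp add: s_def)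
  ultimately have "(\<lambda>n. m n / n * (exp (s n) - 1)) \<longlonglongrightarrow> 1 * (1 / (1 - 2 * 0))"
    by (rule Lim_transform_eventually)
  then show "(\<lambda>n. m n / n * (exp (n * (1 / m n / (1 - 2 * (1 / m n)))) - 1)) \<longlonglongrightarrow> 1"
    by (simp add: s_def)
qed

section \<open>The lower bound for the scaled variance\<close>

theorem theorem2:
  fixes M :: "nat \<Rightarrow> 'a measure"
    and p :: "nat \<Rightarrow> nat"
    and \<Sigma>0 :: "nat \<Rightarrow> real mat"
    and X :: "nat \<Rightarrow> 'a \<Rightarrow> real mat"
    and e :: "nat \<Rightarrow> 'a \<Rightarrow> real vec"
    and B :: "nat \<Rightarrow> real vec set"
    and d m :: "nat \<Rightarrow> real"
    and C c :: real
    and g :: "nat \<Rightarrow> real vec \<Rightarrow> real"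
    and T :: "nat \<Rightarrow> real mat \<times> real vec \<Rightarrow> real"
    and \<beta>0 h gdot :: "nat \<Rightarrow> real vec"
  assumes model: "\<And>n. n > 0 \<Longrightarrow> gaussian_design_noise (M n) n (p n) (\<Sigma>0 n) (X n) (e n)"
    and Sigma_carrier: "\<And>n. n > 0 \<Longrightarrow> \<Sigma>0 n \<in> carrier_mat (p n) (p n)"
    and Sigma_inv: "\<And>n. n > 0 \<Longrightarrow> invertible_mat (\<Sigma>0 n)"
    and Sigma_eig: "(\<lambda>n. 1 / Lambda_min (\<Sigma>0 n)) \<in> O(\<lambda>_. 1)"
    and Sigma_bdd: "(\<lambda>n. mat_max_norm (\<Sigma>0 n)) \<in> O(\<lambda>_. 1)"
    and C_pos: "C > 0"
    and B_carrier: "\<And>n. n > 0 \<Longrightarrow> B n \<subseteq> carrier_vec (p n)"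
    and beta0: "\<And>n. n > 0 \<Longrightarrow> \<beta>0 n \<in> sparse_params (B n) (d n) C"
    and m_pos: "\<And>n. n > 0 \<Longrightarrow> m n > 0"
    and m_rate: "(\<lambda>n. real n) \<in> o(m)"
    and T_meas: "\<And>n. n > 0 \<Longrightarrow> T n \<in> borel_measurable (data_space n (p n))"
    and T_unbiased: "strongly_asymp_unbiased
          (\<lambda>n. data_law (M n) n (p n) (X n) (e n)) (\<lambda>n. sparse_params (B n) (d n) C)
          g \<beta>0 c m T"
    and h_carrier: "\<And>n. n > 0 \<Longrightarrow> h n \<in> carrier_vec (p n)"
    and h_norm: "\<And>n. n > 0 \<Longrightarrow> h n \<bullet> (\<Sigma>0 n *\<^sub>v h n) = 1"
    and h_ball: "\<And>n. n > 0 \<Longrightarrow> \<beta>0 n + (1 / sqrt (m n)) \<cdot>\<^sub>v h n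
          \<in> param_ball (sparse_params (B n) (d n) C) (\<beta>0 n) (c / sqrt (m n))"
    and gdot_carrier: "\<And>n. n > 0 \<Longrightarrow> gdot n \<in> carrier_vec (p n)"
    and g_diff: "(\<lambda>n. sqrt (m n) * (g n (\<beta>0 n + (1 / sqrt (m n)) \<cdot>\<^sub>v h n) - g n (\<beta>0 n))
          - h n \<bullet> gdot n) \<in> o(\<lambda>_. 1)"
  shows "\<exists>r \<in> o(\<lambda>_. 1). \<forall>n>0.
      real n * prob_space.variance (data_law (M n) n (p n) (X n) (e n) (\<beta>0 n)) (T n)
        \<ge> (h n \<bullet> gdot n)\<^sup>2 - r n"
proof -
  define P where "P = (\<lambda>n. data_law (M n) n (p n) (X n) (e n))"
  define S where "S = (\<lambda>n. sparse_params (B n) (d n) C)"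
  define \<beta>1 where "\<beta>1 = (\<lambda>n. \<beta>0 n + (1 / sqrt (m n)) \<cdot>\<^sub>v h n)"
  define E where "E = (\<lambda>\<beta> n. prob_space.expectation (P n (\<beta> n)) (T n))"
  define V where "V = (\<lambda>n. prob_space.variance (P n (\<beta>0 n)) (T n))"
  define D where "D = (\<lambda>n. sqrt (m n) * (E \<beta>1 n - E \<beta>0 n))"
  define a where "a = (\<lambda>n. h n \<bullet> gdot n)"
  define \<rho> where "\<rho> = (\<lambda>n. m n / n * (exp (n * (1 / m n / (1 - 2 * (1 / m n)))) - 1))"

  have \<beta>0_carrier: "\<beta>0 n \<in> carrier_vec (p n)" if "n > 0" for n
    using beta0[OF that] B_carrier[OF that] by (auto simp: sparse_params_def)
  have ball1: "\<beta>1 n \<in> param_ball (S n) (\<beta>0 n) (c / sqrt (m n))" if "n > 0" for n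
    using h_ball[OF that] by (simp add: \<beta>1_def S_def)
  \<comment> \<open>The sign of \<open>c\<close> is read off from the ball around
    \<open>\<beta>0 n\<close>: it contains \<open>\<beta>1 n\<close>, so its radius is nonnegative
    and the centre belongs to it.\<close>
  have ball0: "\<beta>0 n \<in> param_ball (S n) (\<beta>0 n) (c / sqrt (m n))" if "n > 0" for n
  proof -
    have "0 \<le> vec_norm2 (\<beta>1 n - \<beta>0 n)"
      by (simp add: vec_norm2_def scalar_prod_def sum_nonneg)
    then have "0 \<le> c / sqrt (m n)"
      using ball1[OF that] by (simp add: param_ball_def)
    moreover have "vec_norm2 (\<beta>0 n - \<beta>0 n) = 0"
      using \<beta>0_carrier[OF that] by (simp add: vec_norm2_def)
    ultimately show ?thesis
      using beta0[OF that] by (simp add: param_ball_def S_def)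
  qed
  have int0: "\<forall>\<^sub>F n in sequentially. integrable (P n (\<beta>0 n)) (T n) \<and>
      integrable (P n (\<beta>0 n)) (\<lambda>z. (T n z)\<^sup>2)"
    and V_O: "V \<in> O(\<lambda>n. 1 / real n)"
    using T_unbiased unfolding strongly_asymp_unbiased_def P_def V_def by blast+
  have unbiased: "(\<forall>\<^sub>F n in sequentially. integrable (P n (\<beta> n)) (T n)) \<and>
      (\<lambda>n. sqrt (m n) * (E \<beta> n - g n (\<beta> n))) \<longlonglongrightarrow> 0"
    if "\<And>n. n > 0 \<Longrightarrow> \<beta> n \<in> param_ball (S n) (\<beta>0 n) (c / sqrt (m n))" for \<beta>
    using T_unbiased that unfolding strongly_asymp_unbiased_def P_def E_def S_def by blast
  have int1: "\<forall>\<^sub>F n in sequentially. integrable (P n (\<beta>1 n)) (T n)"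
    and bias1: "(\<lambda>n. sqrt (m n) * (E \<beta>1 n - g n (\<beta>1 n))) \<longlonglongrightarrow> 0"
    using unbiased[of \<beta>1] ball1 by blast+
  have bias0: "(\<lambda>n. sqrt (m n) * (E \<beta>0 n - g n (\<beta>0 n))) \<longlonglongrightarrow> 0"
    using unbiased[of \<beta>0] ball0 by blast
  have "(\<lambda>n. sqrt (m n) * (g n (\<beta>1 n) - g n (\<beta>0 n)) - a n) \<longlonglongrightarrow> 0"
    using smalloD_tendsto[OF g_diff] by (simp add: \<beta>1_def a_def)
  \<comment> \<open>The scaled difference of the expectations is the difference of the two scaled
    biases plus the scaled increment of \<open>g\<close>.\<close>
  from tendsto_add[OF tendsto_diff[OF bias1 bias0] this]
  have D_a: "(\<lambda>n. D n - a n) \<longlonglongrightarrow> 0"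
    by (simp add: D_def algebra_simps)

  have V_nonneg: "0 \<le> V n" for n by (simp add: V_def)
  obtain K where "\<forall>\<^sub>F n in sequentially. norm (V n) \<le> K * norm (1 / real n)"
    using V_O by (elim landau_o.bigE)
  then have W: "\<forall>\<^sub>F n in sequentially. 0 \<le> n * V n \<and> n * V n \<le> K"
    using eventually_gt_at_top[of "0::nat"]
  proof eventually_elim
    case (elim n)
    then have "V n \<le> K / n" by simp
    with elim show ?case using V_nonneg[of n] by (simp add: field_simps)
  qed

  \<comment> \<open>The Chapman--Robbins bound is applied with \<open>t = 1 / m n\<close>, and its
    chi-square moment requires \<open>t < 1 / 2\<close>.\<close>
  have "\<forall>\<^sub>F n in sequentially. 1 / m n < 1 / 2"
    using order_tendstoD(2)[OF chi_square_rate(1)[OF m_pos m_rate], of "1 / 2"] by simp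
  then have le: "\<forall>\<^sub>F n in sequentially. (D n)\<^sup>2 \<le> (n * V n) * \<rho> n"
    using int0 int1 eventually_gt_at_top[of "0::nat"]
  proof eventually_elim
    case (elim n)
    then have n: "n > 0" by simp
    have m: "m n > 0" by (rule m_pos[OF n])
    have \<beta>1: "\<beta>1 n = \<beta>0 n + sqrt (1 / m n) \<cdot>\<^sub>v h n"
      by (simp add: \<beta>1_def real_sqrt_divide)
    have "(E \<beta>1 n - E \<beta>0 n)\<^sup>2 \<le> V n * (exp (n * (1 / m n / (1 - 2 * (1 / m n)))) - 1)"
      unfolding E_def V_def P_def \<beta>1
      by (rule Chapman_Robbins_gaussian_design[OF model[OF n] \<beta>0_carrier[OF n] h_carrier[OF n] h_norm[OF n]
            _ _ T_meas[OF n]])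
        (use elim m in \<open>simp_all add: P_def flip: \<beta>1\<close>)
    then have "m n * (E \<beta>1 n - E \<beta>0 n)\<^sup>2 \<le> m n * (V n * (exp (n * (1 / m n / (1 - 2 * (1 / m n)))) - 1))"
      using m by (intro mult_left_mono) auto
    also have "\<dots> = (n * V n) * \<rho> n"
      using n by (simp add: \<rho>_def)
    finally show ?case
      using m by (simp add: D_def power_mult_distrib)
  qed

  \<comment> \<open>The remainder is chosen as the positive part of the deficit, so that the
    inequality holds for every \<open>n\<close> by construction and only its convergence to 0 is
    asymptotic.\<close>
  have "(\<lambda>n. max 0 ((a n)\<^sup>2 - n * V n)) \<longlonglongrightarrow> 0"
    using W chi_square_rate(2)[OF m_pos m_rate, folded \<rho>_def] D_a le by (rule excess_tendsto_0)
  then have "(\<lambda>n. max 0 ((a n)\<^sup>2 - n * V n)) \<in> o(\<lambda>_. 1)"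
    by (intro smalloI_tendsto) simp_all
  then show ?thesis
    by (rule rev_bexI) (auto simp: a_def V_def P_def)
qed

end
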